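(* Let $M$ be an antisymmetric matroid on $E=[n]\cup[n]^*$. Then the first homology group $H_M$ of the transversal basis graph $\mathcal{G}_M$ is generated by the cycles $C$ of $\mathcal{G}_M$ with weight $\eta(C)\le 8$.
   Context: $E=[n]\cup[n]^*$ with involution $i\leftrightarrow i^*$; a skew pair is $\{i,i^*\}$; $\mathcal{T}_n$ (transversals) are $n$-subsets of $E$ with no skew pair, $\mathcal{A}_n$ (almost-transversals) $n$-subsets with exactly one skew pair. An antisymmetric matroid on $E$ is $(E,\mathcal{B})$ with $\mathcal{B}\subseteq\mathcal{T}_n\cup\mathcal{A}_n$ satisfying (B1) $\mathcal{B}\ne\emptyset$; (B2) for $T\in\mathcal{T}_n$ and distinct skew pairs $p,q$, $(T\cup p)\setminus q\in\mathcal{B}$ iff $(T\cup q)\setminus p\in\mathcal{B}$; (Exch) for $B,B'\in\mathcal{B}$ and $e\in B\setminus B'$ with $B\setminus\{e\}$ having no skew pair and $B'\cup\{e\}$ having exactly one skew pair, there is $f\in B'\setminus B$ with both $(B\setminus\{e\})\cup\{f\}$ and $(B'\cup\{e\})\setminus\{f\}$ in $\mathcal{B}$. The transversal basis graph $\mathcal{G}_M$ has vertex set $\mathcal{B}\cap\mathcal{T}_n$, and $B\ne B'$ are adjacent iff either $|B\setminus B'|=1$, or $|B\setminus B'|=2$ and there is $A\in\mathcal{B}\cap\mathcal{A}_n$ with $|B\setminus A|=|B'\setminus A|=1$; edge weight $\eta(BB')=|B\setminus B'|$, and the weight of a cycle is the sum of its edge weights. For a graph $G=(V,E)$ with a linear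 order $\prec$ on $V$, let $\partial_1:\mathbb{Z}^{E}\to\mathbb{Z}^{V}$ be the homomorphism with $\partial_1(vw)=v-w$ for $v\prec w$; the first homology group is $H(G)=\ker\partial_1$, and $H_M:=H(\mathcal{G}_M)$. A cycle $v_1v_2\cdots v_kv_1$ is identified with $\sum_{i=1}^k\epsilon_i\,v_iv_{i+1}\in H(G)$, where $v_{k+1}=v_1$ and $\epsilon_i=1$ if $v_i\prec v_{i+1}$ and $-1$ otherwise. *)

theory Defs
  imports "HOL-Algebra.Free_Abelian_Groups" "HOL-Algebra.Generated_Groups"
begin

section \<open>Antisymmetric matroids\<close>

text \<open>The element \<open>i\<close> of \<open>[n]\<close> is encoded as \<open>Inl i\<close> and \<open>i\<^sup>*\<close> as \<open>Inr i\<close>.\<close>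

type_synonym elt = "nat + nat"

definition ground :: "nat \<Rightarrow> elt set" where
  "ground n = {1..n} <+> {1..n}"

fun star :: "elt \<Rightarrow> elt" where
  "star (Inl i) = Inr i"
| "star (Inr i) = Inl i"

definition skew_pairs :: "nat \<Rightarrow> elt set set" where
  "skew_pairs n = {{e, star e} | e. e \<in> ground n}"

definition skew_pairs_in :: "nat \<Rightarrow> elt set \<Rightarrow> elt set set" where
  "skew_pairs_in n S = {p \<in> skew_pairs n. p \<subseteq> S}"

definition transversals :: "nat \<Rightarrow> elt set set" where
  "transversals n = {T. T \<subseteq> ground n \<and> card T = n \<and> skew_pairs_in n T = {}}"

definition almost_transversals :: "nat \<Rightarrow> elt set set" where
  "almost_transversals n = {A. A \<subseteq> ground n \<and> card A = n \<and> card (skew_pairs_in n A) = 1}"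

locale antisymmetric_matroid =
  fixes n :: nat and \<B> :: "elt set set"
  assumes bases_subset: "\<B> \<subseteq> transversals n \<union> almost_transversals n"
    and B1: "\<B> \<noteq> {}"
    and B2: "\<lbrakk>T \<in> transversals n; p \<in> skew_pairs n; q \<in> skew_pairs n; p \<noteq> q\<rbrakk>
      \<Longrightarrow> (T \<union> p) - q \<in> \<B> \<longleftrightarrow> (T \<union> q) - p \<in> \<B>"
    and Exch: "\<lbrakk>B \<in> \<B>; B' \<in> \<B>; e \<in> B - B';
        skew_pairs_in n (B - {e}) = {}; card (skew_pairs_in n (B' \<union> {e})) = 1\<rbrakk>
      \<Longrightarrow> \<exists>f \<in> B' - B. (B - {e}) \<union> {f} \<in> \<B> \<and> (B' \<union> {e}) - {f} \<in> \<B>"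


section \<open>First homology of a graph\<close>

text \<open>
  A simple graph is given by its vertex set and its set of edges, each edge being a two-element
  set of vertices. \<open>\<int>\<^sup>X\<close> is \<^term>\<open>free_Abelian_group X\<close>. The strict linear order on the vertices
  is a relation \<open>r\<close>, with \<open>(v, w) \<in> r\<close> meaning that \<open>v\<close> precedes \<open>w\<close>.
\<close>

definition edge_boundary :: "('v \<times> 'v) set \<Rightarrow> 'v set \<Rightarrow> 'v \<Rightarrow>\<^sub>0 int" where
  "edge_boundary r e =
    (THE c. \<exists>v w. e = {v, w} \<and> (v, w) \<in> r \<and> c = frag_of v - frag_of w)"

lemma edge_boundary_eq:
  assumes "trans r" "irrefl r" "(v, w) \<in> r"
  shows "edge_boundary r {v, w} = frag_of v - frag_of w"
  unfolding edge_boundary_def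
proof (rule the_equality)
  fix c :: "'a \<Rightarrow>\<^sub>0 int"
  assume "\<exists>x y. {v, w} = {x, y} \<and> (x, y) \<in> r \<and> c = frag_of x - frag_of y"
  then obtain x y where xy: "{v, w} = {x, y}" "(x, y) \<in> r" "c = frag_of x - frag_of y"
    by blast
  have "(w, v) \<notin> r"
    using assms by (meson irreflD transD)
  with xy show "c = frag_of v - frag_of w"
    by (auto simp: doubleton_eq_iff)
qed (use assms in blast)

definition boundary1 :: "('v \<times> 'v) set \<Rightarrow> ('v set \<Rightarrow>\<^sub>0 int) \<Rightarrow> ('v \<Rightarrow>\<^sub>0 int)" where
  "boundary1 r = frag_extend (edge_boundary r)"

definition homology1 :: "'v set \<Rightarrow> 'v set set \<Rightarrow> ('v \<times> 'v) set \<Rightarrow> ('v set \<Rightarrow>\<^sub>0 int) monoid" where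
  "homology1 V E r = (free_Abelian_group E)
     \<lparr>carrier := kernel (free_Abelian_group E) (free_Abelian_group V) (boundary1 r)\<rparr>"

text \<open>
  The list \<open>[v\<^sub>1, \<dots>, v\<^sub>k]\<close> stands for the cycle \<open>v\<^sub>1 v\<^sub>2 \<cdots> v\<^sub>k v\<^sub>1\<close>; positions are counted from
  \<open>0\<close> and taken modulo \<open>k\<close>.
\<close>

definition next_vertex :: "'v list \<Rightarrow> nat \<Rightarrow> 'v" where
  "next_vertex vs i = vs ! (Suc i mod length vs)"

definition is_cycle :: "'v set \<Rightarrow> 'v set set \<Rightarrow> 'v list \<Rightarrow> bool" where
  "is_cycle V E vs \<longleftrightarrow> 3 \<le> length vs \<and> distinct vs \<and> set vs \<subseteq> V \<and>
     (\<forall>i < length vs. {vs ! i, next_vertex vs i} \<in> E)"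

definition cycle_class :: "('v \<times> 'v) set \<Rightarrow> 'v list \<Rightarrow> ('v set \<Rightarrow>\<^sub>0 int)" where
  "cycle_class r vs =
    (\<Sum>i < length vs. frag_cmul (if (vs ! i, next_vertex vs i) \<in> r then 1 else - 1)
                               (frag_of {vs ! i, next_vertex vs i}))"


section \<open>The transversal basis graph\<close>

definition tbg_verts :: "nat \<Rightarrow> elt set set \<Rightarrow> elt set set" where
  "tbg_verts n \<B> = \<B> \<inter> transversals n"

definition tbg_adj :: "nat \<Rightarrow> elt set set \<Rightarrow> elt set \<Rightarrow> elt set \<Rightarrow> bool" where
  "tbg_adj n \<B> B B' \<longleftrightarrow> B \<noteq> B' \<and>
     (card (B - B') = 1 \<or>
      card (B - B') = 2 \<and>
      (\<exists>A \<in> \<B> \<inter> almost_transversals n. card (B - A) = 1 \<and> card (B' - A) = 1))"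

definition tbg_edges :: "nat \<Rightarrow> elt set set \<Rightarrow> elt set set set" where
  "tbg_edges n \<B> =
     {{B, B'} | B B'. B \<in> tbg_verts n \<B> \<and> B' \<in> tbg_verts n \<B> \<and> tbg_adj n \<B> B B'}"

text \<open>The weight is symmetric on vertices, since these all have cardinality \<open>n\<close>.\<close>

definition edge_weight :: "elt set \<Rightarrow> elt set \<Rightarrow> nat" where
  "edge_weight B B' = card (B - B')"

definition cycle_weight :: "elt set list \<Rightarrow> nat" where
  "cycle_weight vs = (\<Sum>i < length vs. edge_weight (vs ! i) (next_vertex vs i))"

definition tbg_homology ::
    "nat \<Rightarrow> elt set set \<Rightarrow> (elt set \<times> elt set) set \<Rightarrow> (elt set set \<Rightarrow>\<^sub>0 int) monoid" where
  "tbg_homology n \<B> r = homology1 (tbg_verts n \<B>) (tbg_edges n \<B>) r"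

end

theory Submission
  imports Defs
begin

text \<open>
  Transversals are vertices of the cube \<open>{0,1}\<^sup>n\<close>, and the weighted path metric of the transversal
  basis graph is the Hamming metric. Fix a base vertex and cone off every edge by geodesics to
  it; the boundary-zero chains are then sums of such triangles, so it suffices to fill those.
  Two geodesics between vertices at distance at most 4 form a closed walk of weight at most 8. At
  larger distance the bases strictly between the two ends form a connected poset under
  comparability, and comparable bases lie on a common geodesic, so induction on the distance
  makes all geodesics agree modulo short cycles. A triangle on an edge is either degenerate, or
  short, or isosceles over an edge of weight 2; in the last case the exchange property gives
  a base on geodesics from both ends of the edge, close enough to the base vertex for induction.
\<close>

section \<open>Set systems with a weak symmetric exchange property\<close>

text \<open>The obstacle is that exchanging two transversals may return two almost-transversals
  instead of vertices of the cube. By (B2) such an almost-transversal marks a two-dimensional face,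
  and such a face is only known to have one of its two diagonals among the bases. At X the absence
  of X \<triangle> {i} decides which one; at Y nothing does. Hence the disjunction in
  \<open>exchange_system\<close>, and every argument about intervals has to survive both outcomes.

  The bound 8 is twice the largest distance at which an open interval may be disconnected. The sets
  {}, {1,2}, {3,4}, {1,2,3,4} satisfy the exchange property, the interval between the first and the
  last consists of two incomparable pairs, and going round through both pairs costs 8. For a top
  with at least five points a separation is impossible: all members of size at most 2 are then
  pairs, and the pairs of each side cover at most two points, whereas every point of the top must be
  covered. The same constant serves the isosceles triangles: an edge of weight 2 with two sides of
  length at most 3 has perimeter at most 8.\<close>

definition sd :: "'a set \<Rightarrow> 'a set \<Rightarrow> 'a set" (infixl "\<triangle>" 65)
  where "X \<triangle> Y = (X - Y) \<union> (Y - X)"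

lemma sd_commute: "X \<triangle> Y = Y \<triangle> X"
  and sd_assoc: "(X \<triangle> Y) \<triangle> Z = X \<triangle> (Y \<triangle> Z)"
  and sd_left_commute: "X \<triangle> (Y \<triangle> Z) = Y \<triangle> (X \<triangle> Z)"
  by (auto simp: sd_def)

lemmas sd_ac = sd_commute sd_assoc sd_left_commute

lemma sd_self [simp]: "X \<triangle> X = {}" "X \<triangle> (X \<triangle> Y) = Y" "X \<triangle> {} = X" "{} \<triangle> X = X"
  by (auto simp: sd_def)

lemma sd_cancel [simp]: "(X \<triangle> A) \<triangle> (Y \<triangle> A) = X \<triangle> Y"
  by (auto simp: sd_def)

lemma card_sd:
  assumes "finite X" "finite Y"
  shows "card (X \<triangle> Y) + 2 * card (X \<inter> Y) = card X + card Y"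
proof -
  have "card X = card (X - Y) + card (X \<inter> Y)" "card Y = card (Y - X) + card (X \<inter> Y)"
    using assms by (metis Un_Diff_Int card_Un_disjoint finite_Diff finite_Int Int_Diff_disjoint
        inf_commute)+
  moreover have "card (X \<triangle> Y) = card (X - Y) + card (Y - X)"
    unfolding sd_def using assms by (intro card_Un_disjoint) auto
  ultimately show ?thesis by simp
qed

lemma card_sd_triangle:
  assumes "finite X" "finite Y" "finite Z"
  shows "card (X \<triangle> Z) \<le> card (X \<triangle> Y) + card (Y \<triangle> Z)"
proof -
  have "X \<triangle> Z \<subseteq> (X \<triangle> Y) \<union> (Y \<triangle> Z)" by (auto simp: sd_def)
  then have "card (X \<triangle> Z) \<le> card ((X \<triangle> Y) \<union> (Y \<triangle> Z))"
    by (rule card_mono[rotated]) (use assms in \<open>auto simp: sd_def\<close>)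
  also have "\<dots> \<le> card (X \<triangle> Y) + card (Y \<triangle> Z)" by (rule card_Un_le)
  finally show ?thesis .
qed

lemma card_sd_between_iff:
  assumes "finite X" "finite Y" "finite Z"
  shows "card (X \<triangle> Y) + card (Y \<triangle> Z) = card (X \<triangle> Z) \<longleftrightarrow> X \<triangle> Y \<subseteq> X \<triangle> Z"
proof -
  have fin: "finite (X \<triangle> Y)" "finite (X \<triangle> Z)" using assms by (auto simp: sd_def)
  have "Y \<triangle> Z = (X \<triangle> Y) \<triangle> (X \<triangle> Z)" by (auto simp: sd_def)
  then have *: "card (Y \<triangle> Z) + 2 * card ((X \<triangle> Y) \<inter> (X \<triangle> Z)) = card (X \<triangle> Y) + card (X \<triangle> Z)"
    using card_sd[OF fin] by simp
  have "card (X \<triangle> Y) + card (Y \<triangle> Z) = card (X \<triangle> Z) \<longleftrightarrow> card ((X \<triangle> Y) \<inter> (X \<triangle> Z)) = card (X \<triangle> Y)"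
    using * by auto
  also have "\<dots> \<longleftrightarrow> X \<triangle> Y \<subseteq> X \<triangle> Z"
    using fin by (metis card_subset_eq inf.absorb_iff1 inf_le1)
  finally show ?thesis .
qed

text \<open>Without the clause on Y this is the exchange axiom of delta-matroids, the case j = i
  being the excluded X \<triangle> {i}. The clause on Y says that the face at Y in directions i and
  j has the corner opposite to Y, or the two other corners, in the system.\<close>

definition exchange_system :: "'a set set \<Rightarrow> bool" where
  "exchange_system \<V> \<longleftrightarrow> (\<forall>X\<in>\<V>. \<forall>Y\<in>\<V>. \<forall>i\<in>X \<triangle> Y. X \<triangle> {i} \<notin> \<V> \<longrightarrow>
     (\<exists>j\<in>X \<triangle> Y - {i}. X \<triangle> {i, j} \<in> \<V> \<and>
        (Y \<triangle> {i, j} \<in> \<V> \<or> Y \<triangle> {i} \<in> \<V> \<and> Y \<triangle> {j} \<in> \<V>)))"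

lemma exchange_systemE:
  assumes "exchange_system \<V>" "X \<in> \<V>" "Y \<in> \<V>" "i \<in> X \<triangle> Y" "X \<triangle> {i} \<notin> \<V>"
  obtains j where "j \<in> X \<triangle> Y" "j \<noteq> i" "X \<triangle> {i, j} \<in> \<V>"
    "Y \<triangle> {i, j} \<in> \<V> \<or> Y \<triangle> {i} \<in> \<V> \<and> Y \<triangle> {j} \<in> \<V>"
  using assms unfolding exchange_system_def by blast

lemma exchange_system_twist:
  assumes "exchange_system \<V>"
  shows "exchange_system {X. X \<triangle> A \<in> \<V>}"
  unfolding exchange_system_def
proof (intro ballI impI)
  fix X Y i
  assume *: "X \<in> {X. X \<triangle> A \<in> \<V>}" "Y \<in> {X. X \<triangle> A \<in> \<V>}" "i \<in> X \<triangle> Y"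
    "X \<triangle> {i} \<notin> {X. X \<triangle> A \<in> \<V>}"
  have sw: "Z \<triangle> A \<triangle> W = Z \<triangle> W \<triangle> A" for Z W
    by (simp add: sd_ac)
  from * have "i \<in> (X \<triangle> A) \<triangle> (Y \<triangle> A)" "X \<triangle> A \<triangle> {i} \<notin> \<V>" "X \<triangle> A \<in> \<V>" "Y \<triangle> A \<in> \<V>"
    by (simp_all add: sw)
  from exchange_systemE[OF assms this(3,4,1,2)]
  show "\<exists>j\<in>X \<triangle> Y - {i}. X \<triangle> {i, j} \<in> {X. X \<triangle> A \<in> \<V>} \<and>
      (Y \<triangle> {i, j} \<in> {X. X \<triangle> A \<in> \<V>} \<or> Y \<triangle> {i} \<in> {X. X \<triangle> A \<in> \<V>} \<and> Y \<triangle> {j} \<in> {X. X \<triangle> A \<in> \<V>})"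
    by (simp add: sw) blast
qed

text \<open>Exchange at a point s of S pairs s with another point of S, which is harmless, or with
  i. In the latter case both outcomes at the upper end remove i: they leave S - {s} or S, and
  neither is empty because S has two points.\<close>

lemma exchange_system_below:
  assumes "exchange_system \<V>" "{} \<in> \<V>" "insert i S \<in> \<V>" "i \<notin> S" "2 \<le> card S"
  shows "\<exists>X\<in>\<V>. X \<noteq> {} \<and> X \<subseteq> S"
proof -
  obtain s where s: "s \<in> S" using assms(5) by fastforce
  have "finite S" using assms(5) by (metis card.infinite not_numeral_le_zero)
  then have "card (S - {s}) \<noteq> 0" using assms(5) s by simp
  then have S1: "S - {s} \<noteq> {}" by (metis card.empty)
  show ?thesis
  proof (cases "{s} \<in> \<V>")
    case True
    then show ?thesis using s by (intro bexI[of _ "{s}"]) auto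
  next
    case False
    then obtain j where j: "j \<in> insert i S" "j \<noteq> s" "{s, j} \<in> \<V>"
      "insert i S \<triangle> {s, j} \<in> \<V> \<or> insert i S \<triangle> {s} \<in> \<V> \<and> insert i S \<triangle> {j} \<in> \<V>"
      using exchange_systemE[OF assms(1-3), of s] s by auto
    show ?thesis
    proof (cases "j = i")
      case True
      have "i \<noteq> s" using s assms(4) by blast
      then have a: "insert i S \<triangle> {s, i} = S - {s}"
        using s assms(4) unfolding sd_def by blast
      have b: "insert i S \<triangle> {i} = S" using assms(4) unfolding sd_def by blast
      have "S - {s} \<in> \<V> \<or> S \<in> \<V>" using j(4) unfolding True a b by blast
      moreover have "S \<noteq> {}" "S - {s} \<subseteq> S" using s by auto
      ultimately show ?thesis using S1 by (metis order_refl)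
    next
      case False
      then show ?thesis using j s by (intro bexI[of _ "{s, j}"]) auto
    qed
  qed
qed

text \<open>Twisting by T turns the interval upside down: T becomes the empty set and Y becomes T -
  Y, with i as its extra point.\<close>

lemma exchange_system_above:
  assumes "exchange_system \<V>" "T \<in> \<V>" "Y \<in> \<V>" "insert i Y \<subseteq> T" "i \<notin> Y" "2 \<le> card (T - insert i Y)"
  shows "\<exists>Z\<in>\<V>. Z \<noteq> T \<and> insert i Y \<subseteq> Z \<and> Z \<subseteq> T"
proof -
  have eq: "insert i (T - insert i Y) \<triangle> T = Y"
    using assms(4,5) by (auto simp: sd_def)
  have "\<exists>X\<in>{X. X \<triangle> T \<in> \<V>}. X \<noteq> {} \<and> X \<subseteq> T - insert i Y"
    using assms by (intro exchange_system_below exchange_system_twist[where A=T]) (auto simp: eq)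
  then obtain X where X: "X \<triangle> T \<in> \<V>" "X \<noteq> {}" "X \<subseteq> T - insert i Y" by blast
  then have "X \<triangle> T \<noteq> T" "insert i Y \<subseteq> X \<triangle> T" "X \<triangle> T \<subseteq> T"
    using assms(4) by (auto simp: sd_def)
  with X show ?thesis by blast
qed

section \<open>Connectedness of open intervals whose ends are at distance at least 5\<close>

text \<open>A hypothetical separation of the open interval between \<open>{}\<close> and \<open>T\<close> into two mutually
  incomparable parts; the locale is shown to be inconsistent.\<close>
locale separated_interval =
  fixes \<V> :: "'a set set" and T :: "'a set" and L M :: "'a set set"
  assumes exchange: "exchange_system \<V>"
    and bot: "{} \<in> \<V>" and top: "T \<in> \<V>" and card_top: "5 \<le> card T"
    and cover: "L \<union> M = {X\<in>\<V>. X \<noteq> {} \<and> X \<subset> T}"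
    and disjoint: "L \<inter> M = {}"
    and nonempty: "L \<noteq> {}" "M \<noteq> {}"
    and incomparable: "\<And>X Y. X \<in> L \<Longrightarrow> Y \<in> M \<Longrightarrow> \<not> X \<subseteq> Y \<and> \<not> Y \<subseteq> X"
begin

text \<open>The sides play symmetric roles, so each fact below is proved for one of them and
  transferred to the other by this instance.\<close>

lemma swap: "separated_interval \<V> T M L"
  using exchange bot top card_top cover disjoint nonempty incomparable
  by unfold_locales (auto simp: Un_commute Int_commute)

lemma finite_top: "finite T"
  using card_top by (metis card.infinite not_numeral_le_zero)

lemma side: "X \<in> L \<or> X \<in> M" if "X \<in> \<V>" "X \<noteq> {}" "X \<subset> T"
  using that cover by blast

lemma inL: "X \<in> \<V>" "X \<noteq> {}" "X \<subset> T" if "X \<in> L"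
  using that cover by blast+

lemma no_common_lower_bound:
  assumes "X \<in> L" "Y \<in> M" "Z \<in> \<V>" "Z \<noteq> {}" "Z \<subset> T"
  shows "\<not> (Z \<subseteq> X \<and> Z \<subseteq> Y)"
  using side[OF assms(3-5)] incomparable[OF assms(1), of Z] incomparable[of Z Y] assms(2) by auto

text \<open>Exchange from the empty set towards X at i picks up at most one further point of X. The
  result lies below X and therefore on its side.\<close>

lemma small_member:
  assumes "X \<in> L" "i \<in> X"
  obtains Y where "Y \<in> L" "card Y \<le> 2" "i \<in> Y" "Y \<subseteq> X"
proof -
  have "\<exists>Y\<in>\<V>. Y \<subseteq> X \<and> card Y \<le> 2 \<and> i \<in> Y"
  proof (cases "{i} \<in> \<V>")
    case True
    then show ?thesis using assms(2) by (intro bexI[of _ "{i}"]) auto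
  next
    case False
    then obtain j where "j \<in> X" "{i, j} \<in> \<V>"
      using exchange_systemE[OF exchange bot, of X i] assms inL[OF assms(1)] by auto
    then show ?thesis using assms(2) by (intro bexI[of _ "{i, j}"]) (auto simp: card_insert_if)
  qed
  then obtain Y where Y: "Y \<in> \<V>" "Y \<subseteq> X" "card Y \<le> 2" "i \<in> Y" by blast
  then have "Y \<in> L \<or> Y \<in> M" using side inL[OF assms(1)] by blast
  then have "Y \<in> L" using incomparable assms(1) Y(2) by blast
  with Y that show thesis by blast
qed

text \<open>Five points of T are needed here: Y and i occupy at most three, which leaves the two
  that \<open>exchange_system_above\<close> asks for.\<close>

lemma above:
  assumes "Y \<in> L" "card Y \<le> 2" "i \<in> T" "i \<notin> Y"
  obtains Z where "Z \<in> L" "insert i Y \<subseteq> Z"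
proof -
  have Y: "Y \<in> \<V>" "Y \<noteq> {}" "Y \<subset> T" "insert i Y \<subseteq> T" using inL[OF assms(1)] assms(3) by auto
  have "finite Y" using Y finite_top finite_subset by blast
  then have "2 \<le> card (T - insert i Y)"
    using card_top assms(2,4) card_Diff_subset[of "insert i Y" T] Y by simp
  then obtain Z where Z: "Z \<in> \<V>" "Z \<noteq> T" "insert i Y \<subseteq> Z" "Z \<subseteq> T"
    using exchange_system_above[OF exchange top Y(1,4) assms(4)] by blast
  then have "Z \<in> L \<or> Z \<in> M" using side by blast
  then have "Z \<in> L" using incomparable assms(1) Z(3) by blast
  with Z that show thesis by blast
qed

text \<open>If Y exceeded X by i alone, the member above \<open>insert i X\<close> on the side of X
  would contain Y.\<close>

lemma overlap:
  assumes "X \<in> L" "Y \<in> M" "card X \<le> 2"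
  shows "Y - X \<noteq> {i}"
proof
  assume i: "Y - X = {i}"
  moreover have "i \<in> T" "i \<notin> X"
    using i separated_interval.inL(3)[OF swap assms(2)] by auto
  then obtain Z where Z: "Z \<in> L" "insert i X \<subseteq> Z" using above[OF assms(1,3)] by blast
  ultimately have "Y \<subseteq> Z" by blast
  with incomparable[OF Z(1) assms(2)] show False by simp
qed

text \<open>Incomparability makes every member of L avoid i, so {i} would exceed a small one by
  exactly one point, against \<open>overlap\<close>.\<close>

lemma singleton_notin_right: "{i} \<notin> M"
proof
  assume i: "{i} \<in> M"
  obtain X k where "X \<in> L" "k \<in> X" using nonempty(1) inL(2) by blast
  then obtain Y where Y: "Y \<in> L" "card Y \<le> 2" using small_member by blast
  then have "i \<notin> Y" using incomparable i by blast
  then show False using overlap[OF Y(1) i Y(2), of i] by auto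
qed

lemma no_singleton: "{i} \<notin> \<V>" if "i \<in> T"
proof -
  have "{i} \<subset> T" using that card_top by auto
  with side[of "{i}"] singleton_notin_right separated_interval.singleton_notin_right[OF swap]
  show ?thesis by blast
qed

text \<open>Incomparability makes every member of L contain s. Deleting s from a large enough one
  and applying \<open>exchange_system_below\<close> produces a member lying under both
  sides.\<close>

lemma cosingleton_notin_right: "T - {s} \<notin> M" if "s \<in> T"
proof
  assume s: "T - {s} \<in> M"
  obtain X where X: "X \<in> L" using nonempty by blast
  have sX: "s \<in> X" if "X \<in> L" for X
    using incomparable[OF that s] inL(3)[OF that] by blast
  obtain Y where Y: "Y \<in> L" "card Y \<le> 2" using small_member[OF X sX[OF X]] by blast
  then have "finite Y" "Y \<subseteq> T" using inL(3) finite_top finite_subset by blast+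
  then obtain v where v: "v \<in> T" "v \<notin> Y"
    using inL(3)[OF Y(1)] by blast
  \<comment> \<open>Enlarging Y by v ensures that two points other than s survive in Z - {s}: the
    new point v and a point u of Y.\<close>
  obtain Z where Z: "Z \<in> L" "insert v Y \<subseteq> Z" using above[OF Y v] by blast
  have "Y \<noteq> {s}" using separated_interval.singleton_notin_right[OF swap] Y(1) by blast
  then obtain u where u: "u \<in> Y" "u \<noteq> s" using inL(2)[OF Y(1)] by blast
  have "card {u, v} \<le> card (Z - {s})"
    using u v Z sX[OF Y(1)] finite_subset[OF _ finite_top] inL(3)[OF Z(1)] by (intro card_mono) auto
  moreover have "u \<noteq> v" using u v by blast
  ultimately have "2 \<le> card (Z - {s})" by simp
  moreover have "insert s (Z - {s}) \<in> \<V>" using sX Z(1) inL by (simp add: insert_absorb)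
  ultimately obtain W where W: "W \<in> \<V>" "W \<noteq> {}" "W \<subseteq> Z - {s}"
    using exchange_system_below[OF exchange bot, of s "Z - {s}"] by blast
  then have sub: "W \<subset> T" "W \<subseteq> Z" "W \<subseteq> T - {s}" using inL(3)[OF Z(1)] by auto
  show False using no_common_lower_bound[OF Z(1) s W(1,2) sub(1)] sub(2,3) by blast
qed

lemma no_cosingleton: "T - {s} \<notin> \<V>" if "s \<in> T"
proof -
  have "card (T - {s}) \<noteq> 0" using card_top finite_top that by simp
  then have "T - {s} \<noteq> {}" by (metis card.empty)
  moreover have "T - {s} \<subset> T" using that by blast
  ultimately show ?thesis
    using side[of "T - {s}"] cosingleton_notin_right[OF that]
      separated_interval.cosingleton_notin_right[OF swap that] by metis
qed

text \<open>Since there are no singletons, the exchange must add a second point. When X is T, the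
  absence of cosingletons also rules out the second alternative at the upper end, so the complement
  of the pair is a member.\<close>

lemma pair:
  assumes "i \<in> X" "X \<subseteq> T" "X \<in> \<V>"
  obtains j where "j \<in> X" "j \<noteq> i" "{i, j} \<in> \<V>" "T - {i, j} \<in> \<V> \<or> X \<noteq> T"
proof -
  have i: "i \<in> {} \<triangle> X" "{} \<triangle> {i} \<notin> \<V>" using assms no_singleton by auto
  obtain j where j: "j \<in> X" "j \<noteq> i" "{i, j} \<in> \<V>"
    "X \<triangle> {i, j} \<in> \<V> \<or> X \<triangle> {i} \<in> \<V> \<and> X \<triangle> {j} \<in> \<V>"
    using exchange_systemE[OF exchange bot assms(3) i] by auto
  have "T \<triangle> {i} = T - {i}" "T \<triangle> {i, j} = T - {i, j}" if "X = T"
    using that j assms by (auto simp: sd_def)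
  with j no_cosingleton assms that show thesis by metis
qed

lemma pair_proper: "{i, j} \<subset> T" if "i \<in> T" "j \<in> T"
proof -
  have "card {i, j} \<le> 2" by (simp add: card_insert_if)
  with that card_top show ?thesis by auto
qed

lemma pairs_disjoint:
  assumes "{s, t} \<in> L" "{s, u} \<in> M"
  shows False
proof -
  have "u \<noteq> s" using singleton_notin_right assms(2) by auto
  moreover have "u \<noteq> t" using disjoint assms by auto
  ultimately have "{s, u} - {s, t} = {u}" by auto
  moreover have "card {s, t} \<le> 2" by (simp add: card_insert_if)
  ultimately show False using overlap assms by blast
qed

text \<open>Take a pair {s, t} of L whose complement is a member, and a third point u covered by L.
  A small member of M misses s and t, which forces the complement into M. Then the pair through u
  inside the complement is in M as well, against \<open>pairs_disjoint\<close>.\<close>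

lemma card_pairs: "card {s \<in> T. \<exists>t. {s, t} \<in> L} \<le> 2"
proof (rule ccontr)
  let ?W = "{s \<in> T. \<exists>t. {s, t} \<in> L}"
  assume *: "\<not> card ?W \<le> 2"
  then have "card ?W \<noteq> 0" by linarith
  then have "?W \<noteq> {}" by (metis card.empty)
  then obtain s x where sT: "s \<in> T" and sx: "{s, x} \<in> L" by blast
  obtain t where t: "t \<in> T" "t \<noteq> s" "{s, t} \<in> \<V>" "T - {s, t} \<in> \<V>"
    using pair[OF sT subset_refl top] by blast
  have st: "{s, t} \<in> L"
    using side[OF t(3) _ pair_proper[OF sT t(1)]] pairs_disjoint[OF sx] by blast
  have "\<not> ?W \<subseteq> {s, t}"
    using * card_mono[of "{s, t}" ?W] by (auto simp: card_insert_if split: if_splits)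
  then obtain u x where u: "u \<in> T" "{u, x} \<in> L" "u \<noteq> s" "u \<noteq> t" by blast
  obtain Y w where "Y \<in> M" "w \<in> Y"
    using nonempty(2) separated_interval.inL(2)[OF swap] by blast
  then obtain Y where Y: "Y \<in> M" "w \<in> Y" "card Y \<le> 2"
    using separated_interval.small_member[OF swap] by metis
  have Yd: "Y \<subseteq> T" "finite Y"
    using separated_interval.inL(3)[OF swap Y(1)] finite_top finite_subset by blast+
  have "v \<notin> {s, t}" if "v \<in> Y" for v
  proof
    assume v: "v \<in> {s, t}"
    have "\<exists>y. Y = {v, y}"
    proof -
      have "card (Y - {v}) \<le> 1" using Y(3) that Yd by simp
      then have "Y - {v} = {} \<or> (\<exists>y. Y - {v} = {y})"
        using Yd by (metis card_0_eq card_1_singletonE finite_Diff le_Suc_eq le_zero_eq One_nat_def)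
      then show ?thesis using that by (metis insert_Diff insert_absorb2)
    qed
    then obtain y where "Y = {v, y}" by blast
    then have "{v, y} \<in> M" using Y(1) by blast
    with pairs_disjoint[of v _ y] st v show False by (metis insert_commute insertE singletonD)
  qed
  then have sub: "Y \<subseteq> T - {s, t}" using Yd by blast
  have "T - {s, t} \<noteq> {}" "T - {s, t} \<subset> T" using u sT by auto
  then have M: "T - {s, t} \<in> M"
    using side[OF t(4)] incomparable sub Y(1) by blast
  have "u \<in> T - {s, t}" using u by blast
  from pair[OF this _ t(4)]
  obtain v where v: "v \<in> T - {s, t}" "{u, v} \<in> \<V>" by blast
  have "{u, v} \<in> L \<or> {u, v} \<in> M" using side[OF v(2) _ pair_proper] u v by blast
  then have "{u, v} \<in> M" using incomparable[OF _ M] v u by blast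
  with u pairs_disjoint show False by blast
qed

text \<open>Every point of T lies in a member pair, and the pairs of each side cover at most two
  points, so T has at most four.\<close>

lemma contradiction: False
proof -
  let ?W = "\<lambda>L. {s \<in> T. \<exists>t. {s, t} \<in> L}"
  have "T \<subseteq> ?W L \<union> ?W M"
  proof
    fix s assume s: "s \<in> T"
    obtain t where t: "t \<in> T" "{s, t} \<in> \<V>" using pair[OF s subset_refl top] by blast
    then show "s \<in> ?W L \<union> ?W M" using side[OF t(2) _ pair_proper] s by blast
  qed
  then have "card T \<le> card (?W L \<union> ?W M)"
    by (intro card_mono) (use finite_top in auto)
  also have "\<dots> \<le> card (?W L) + card (?W M)" by (rule card_Un_le)
  also have "\<dots> \<le> 2 + 2"
    using card_pairs separated_interval.card_pairs[OF swap] by (rule add_mono)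
  finally show False using card_top by simp
qed

end

text \<open>Closure under comparability makes L and its complement in the open interval mutually
  incomparable, so a nonempty complement would be a separation.\<close>

lemma exchange_system_interval_connected:
  assumes "exchange_system \<V>" "{} \<in> \<V>" "T \<in> \<V>" "5 \<le> card T"
    and "L \<noteq> {}" "L \<subseteq> {X\<in>\<V>. X \<noteq> {} \<and> X \<subset> T}"
    and "\<And>X Y. X \<in> L \<Longrightarrow> Y \<in> \<V> \<Longrightarrow> Y \<noteq> {} \<Longrightarrow> Y \<subset> T \<Longrightarrow> X \<subseteq> Y \<or> Y \<subseteq> X \<Longrightarrow> Y \<in> L"
  shows "L = {X\<in>\<V>. X \<noteq> {} \<and> X \<subset> T}"
proof (rule ccontr)
  assume "L \<noteq> {X\<in>\<V>. X \<noteq> {} \<and> X \<subset> T}"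
  with assms have "separated_interval \<V> T L ({X\<in>\<V>. X \<noteq> {} \<and> X \<subset> T} - L)"
    by unfold_locales blast+
  then show False by (rule separated_interval.contradiction)
qed

section \<open>Cycles and walks\<close>

text \<open>The chain of a step from v to w along an edge. The sign makes its boundary v - w however
  the order directs the edge, so boundaries telescope along walks.\<close>

definition oriented_edge :: "('v \<times> 'v) set \<Rightarrow> 'v \<Rightarrow> 'v \<Rightarrow> ('v set \<Rightarrow>\<^sub>0 int)" where
  "oriented_edge r v w = frag_cmul (if (v, w) \<in> r then 1 else - 1) (frag_of {v, w})"

text \<open>The target monoid is left open because both the weight and the chain of a walk are such
  sums.\<close>

fun path_sum :: "('v \<Rightarrow> 'v \<Rightarrow> 'a::comm_monoid_add) \<Rightarrow> 'v list \<Rightarrow> 'a" where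
  "path_sum f (x # y # zs) = f x y + path_sum f (y # zs)"
| "path_sum f _ = 0"

lemma path_sum_append: "path_sum f (us @ x # ys) = path_sum f (us @ [x]) + path_sum f (x # ys)"
proof (induction us)
  case (Cons u us)
  then show ?case by (cases us) (simp_all add: add.assoc)
qed simp

lemma path_sum_nth: "path_sum f (x # xs) = (\<Sum>i<length xs. f ((x # xs) ! i) (xs ! i))"
proof (induction xs arbitrary: x)
  case (Cons y xs)
  then show ?case by (simp add: sum.lessThan_Suc_shift del: sum.lessThan_Suc)
qed simp

lemma path_sum_closed:
  assumes "vs \<noteq> []"
  shows "path_sum f (vs @ [hd vs]) = (\<Sum>i<length vs. f (vs ! i) (next_vertex vs i))"
proof -
  obtain x xs where vs: "vs = x # xs" using assms by (cases vs) auto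
  have "path_sum f (x # (xs @ [x])) = (\<Sum>i<length vs. f ((x # xs @ [x]) ! i) ((xs @ [x]) ! i))"
    unfolding path_sum_nth by (simp add: vs)
  also have "\<dots> = (\<Sum>i<length vs. f (vs ! i) (next_vertex vs i))"
  proof (rule sum.cong[OF refl])
    fix i assume "i \<in> {..<length vs}"
    then have i: "i < length vs" by simp
    then have "(x # xs @ [x]) ! i = vs ! i"
      unfolding vs using nth_append[of "x # xs" "[x]" i] by simp
    moreover have "(xs @ [x]) ! i = next_vertex vs i"
      using i by (cases "i = length xs") (simp_all add: next_vertex_def vs nth_append)
    ultimately show "f ((x # xs @ [x]) ! i) ((xs @ [x]) ! i) = f (vs ! i) (next_vertex vs i)"
      by simp
  qed
  finally show ?thesis by (simp add: vs)
qed

lemma cycle_class_path_sum: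
  assumes "vs \<noteq> []"
  shows "cycle_class r vs = path_sum (oriented_edge r) (vs @ [hd vs])"
  unfolding path_sum_closed[OF assms] cycle_class_def oriented_edge_def ..

section \<open>Chains and boundaries of walks in a graph with ordered vertices\<close>

locale ordered_graph =
  fixes V :: "'v set" and E :: "'v set set" and r :: "('v \<times> 'v) set"
  assumes edge_cases: "e \<in> E \<Longrightarrow> \<exists>v\<in>V. \<exists>w\<in>V. v \<noteq> w \<and> e = {v, w}"
    and order: "strict_linear_order_on V r"
begin

lemma edge_verts: "a \<in> V" "b \<in> V" "a \<noteq> b" if "{a, b} \<in> E"
  using edge_cases[OF that] by (auto simp: doubleton_eq_iff)

lemma order_cases: "(a, b) \<in> r \<or> (b, a) \<in> r" "\<not> ((a, b) \<in> r \<and> (b, a) \<in> r)"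
  if "a \<in> V" "b \<in> V" "a \<noteq> b"
  using order that unfolding strict_linear_order_on_def
  by (auto simp: total_on_def irrefl_def dest: transD)

lemma oriented_edge_swap: "oriented_edge r b a = - oriented_edge r a b" if "{a, b} \<in> E"
  using order_cases[OF edge_verts[OF that]] by (auto simp: oriented_edge_def insert_commute)

lemma boundary1_oriented_edge:
  "boundary1 r (oriented_edge r a b) = frag_of a - frag_of b" if ab: "{a, b} \<in> E"
proof -
  have ir: "trans r" "irrefl r" using order unfolding strict_linear_order_on_def by auto
  consider "(a, b) \<in> r" | "(b, a) \<in> r" "(a, b) \<notin> r"
    using order_cases[OF edge_verts[OF ab]] by blast
  then show ?thesis
  proof cases
    case 1
    then show ?thesis
      by (simp add: oriented_edge_def boundary1_def edge_boundary_eq[OF ir])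
  next
    case 2
    then have "edge_boundary r {a, b} = frag_of b - frag_of a"
      using edge_boundary_eq[OF ir 2(1)] by (simp add: insert_commute)
    then show ?thesis
      using 2 by (simp add: oriented_edge_def boundary1_def frag_extend_minus)
  qed
qed

definition is_walk :: "'v list \<Rightarrow> bool" where
  "is_walk xs \<longleftrightarrow> set xs \<subseteq> V \<and> successively (\<lambda>x y. {x, y} \<in> E) xs"

lemma is_walk_simps [simp]:
  "is_walk []" "is_walk [x] \<longleftrightarrow> x \<in> V"
  "is_walk (x # y # zs) \<longleftrightarrow> x \<in> V \<and> {x, y} \<in> E \<and> is_walk (y # zs)"
  by (auto simp: is_walk_def)

lemma is_walk_append: "is_walk (us @ x # ys) \<longleftrightarrow> is_walk (us @ [x]) \<and> is_walk (x # ys)"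
proof (induction us)
  case Nil
  then show ?case by (cases ys) auto
next
  case (Cons u us)
  then show ?case by (cases us) auto
qed

lemma boundary1_path_sum:
  "is_walk (x # xs) \<Longrightarrow> boundary1 r (path_sum (oriented_edge r) (x # xs)) = frag_of x - frag_of (last (x # xs))"
proof (induction xs arbitrary: x)
  case Nil
  then show ?case by (simp add: boundary1_def)
next
  case (Cons y ys)
  have "boundary1 r (path_sum (oriented_edge r) (x # y # ys))
      = boundary1 r (oriented_edge r x y) + boundary1 r (path_sum (oriented_edge r) (y # ys))"
    by (simp add: boundary1_def frag_extend_add)
  also have "\<dots> = frag_of x - frag_of (last (x # y # ys))"
    using Cons by (simp add: boundary1_oriented_edge)
  finally show ?case .
qed

lemma keys_path_sum: "is_walk xs \<Longrightarrow> Poly_Mapping.keys (path_sum (oriented_edge r) xs) \<subseteq> E"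
proof (induction "oriented_edge r" xs rule: path_sum.induct)
  case (1 x y zs)
  have "Poly_Mapping.keys (oriented_edge r x y) \<subseteq> E"
    using 1(2) by (auto simp: oriented_edge_def keys_frag_of)
  with 1 show ?case
    using keys_add[of "oriented_edge r x y" "path_sum (oriented_edge r) (y # zs)"] by auto
qed auto

lemma is_cycle_iff:
  "is_cycle V E vs \<longleftrightarrow> 3 \<le> length vs \<and> distinct vs \<and> is_walk (vs @ [hd vs])"
proof (cases "vs = []")
  case False
  have "(\<forall>i<length vs. {vs ! i, next_vertex vs i} \<in> E)
      \<longleftrightarrow> successively (\<lambda>x y. {x, y} \<in> E) (vs @ [hd vs])"
  proof -
    have "(vs @ [hd vs]) ! Suc i = next_vertex vs i" "(vs @ [hd vs]) ! i = vs ! i" if "i < length vs" for i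
      using that False
      by (cases "Suc i = length vs"; simp add: next_vertex_def nth_append hd_conv_nth)+
    then show ?thesis by (auto simp: successively_conv_nth)
  qed
  with False show ?thesis by (auto simp: is_cycle_def is_walk_def)
qed (simp add: is_cycle_def)

lemma kernel_iff:
  "x \<in> carrier (homology1 V E r) \<longleftrightarrow> Poly_Mapping.keys x \<subseteq> E \<and> boundary1 r x = 0"
  by (auto simp: homology1_def kernel_def)

text \<open>This makes the kernel a subgroup, hence \<open>homology1 V E r\<close> a group. The
  boundary of an edge is recovered up to sign from that of a step along it.\<close>

lemma boundary1_hom: "boundary1 r \<in> hom (free_Abelian_group E) (free_Abelian_group V)"
proof (rule homI)
  fix x assume "x \<in> carrier (free_Abelian_group E)"
  then have x: "Poly_Mapping.keys x \<subseteq> E" by simp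
  have "Poly_Mapping.keys (edge_boundary r e) \<subseteq> V" if e: "e \<in> E" for e
  proof -
    obtain v w where vw: "e = {v, w}" "v \<in> V" "w \<in> V" "v \<noteq> w" using edge_cases[OF e] by blast
    have "Poly_Mapping.keys (frag_of v - frag_of w) \<subseteq> V" "Poly_Mapping.keys (frag_of w - frag_of v) \<subseteq> V"
      using vw keys_diff[of "frag_of v" "frag_of w"] keys_diff[of "frag_of w" "frag_of v"]
      by (auto simp: keys_frag_of)
    moreover have "boundary1 r (oriented_edge r v w) = frag_of v - frag_of w"
      using boundary1_oriented_edge e vw by simp
    then have "edge_boundary r e = frag_of v - frag_of w \<or> - edge_boundary r e = frag_of v - frag_of w"
      by (auto simp: oriented_edge_def boundary1_def vw frag_extend_minus split: if_splits)
    then have "edge_boundary r e = frag_of v - frag_of w \<or> edge_boundary r e = frag_of w - frag_of v"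
      by (metis minus_diff_eq minus_minus)
    ultimately show ?thesis by metis
  qed
  then show "boundary1 r x \<in> carrier (free_Abelian_group V)"
    using keys_frag_extend[of "edge_boundary r" x] x unfolding boundary1_def by fastforce
qed (simp add: boundary1_def frag_extend_add)

lemma group_homology1: "group (homology1 V E r)"
proof -
  interpret group_hom "free_Abelian_group E" "free_Abelian_group V" "boundary1 r"
    using boundary1_hom by (simp add: group_hom_def group_hom_axioms_def)
  show ?thesis
    unfolding homology1_def
    by (rule subgroup.subgroup_is_group[OF subgroup_kernel]) simp
qed

lemma homology1_ops [simp]:
  "\<one>\<^bsub>homology1 V E r\<^esub> = 0" "x \<otimes>\<^bsub>homology1 V E r\<^esub> y = x + y"
  by (simp_all add: homology1_def free_Abelian_group_def)

lemma inv_homology1: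
  assumes "x \<in> carrier (homology1 V E r)"
  shows "inv\<^bsub>homology1 V E r\<^esub> x = - x"
  using assms by (intro group.inv_equality[OF group_homology1])
    (auto simp: kernel_iff boundary1_def frag_extend_minus)

lemma cycle_class_in_kernel:
  assumes "is_cycle V E vs"
  shows "cycle_class r vs \<in> carrier (homology1 V E r)"
proof -
  obtain x xs where vs: "vs = x # xs" using assms by (cases vs) (auto simp: is_cycle_def)
  have w: "is_walk (x # xs @ [x])" using assms by (simp add: is_cycle_iff vs)
  have "cycle_class r vs = path_sum (oriented_edge r) (x # xs @ [x])"
    by (simp add: cycle_class_path_sum vs)
  then show ?thesis
    using keys_path_sum[OF w] boundary1_path_sum[OF w] by (simp add: kernel_iff)
qed

end

section \<open>Graphs whose weighted path metric has connected intervals\<close>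

text \<open>What the homology argument uses of the basis graph, in metric terms; h is half the
  permitted cycle weight. Equality in the triangle inequality replaces inclusion of symmetric
  differences, \<open>balanced\<close> is the trace of their parity, and
  \<open>interval_connected\<close> speaks of sets K closed under comparability within an open
  interval.\<close>

locale geodesic_graph = ordered_graph V E r for V :: "'v set" and E r +
  fixes d :: "'v \<Rightarrow> 'v \<Rightarrow> nat" and h :: nat
  assumes d_commute: "a \<in> V \<Longrightarrow> b \<in> V \<Longrightarrow> d a b = d b a"
    and d_eq_0: "a \<in> V \<Longrightarrow> b \<in> V \<Longrightarrow> d a b = 0 \<longleftrightarrow> a = b"
    and triangle: "a \<in> V \<Longrightarrow> b \<in> V \<Longrightarrow> c \<in> V \<Longrightarrow> d a c \<le> d a b + d b c"
    and edge_le: "{a, b} \<in> E \<Longrightarrow> d a b \<le> 2"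
    and two_le: "2 \<le> h"
    and geodesic_step: "a \<in> V \<Longrightarrow> b \<in> V \<Longrightarrow> a \<noteq> b \<Longrightarrow> \<exists>m. {a, m} \<in> E \<and> d a m + d m b = d a b"
    and balanced: "{a, b} \<in> E \<Longrightarrow> c \<in> V \<Longrightarrow>
      d a c = d a b + d b c \<or> d b c = d a b + d a c \<or> d a c = d b c"
    and descend: "{a, b} \<in> E \<Longrightarrow> c \<in> V \<Longrightarrow> d a c = d b c \<Longrightarrow> h \<le> d a c \<Longrightarrow>
      \<exists>m\<in>V. m \<noteq> c \<and> d a m + d m c = d a c \<and> d b m + d m c = d b c"
    and interval_connected: "a \<in> V \<Longrightarrow> b \<in> V \<Longrightarrow> h < d a b \<Longrightarrow> K \<noteq> {} \<Longrightarrow>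
      K \<subseteq> {m\<in>V - {a, b}. d a m + d m b = d a b} \<Longrightarrow>
      (\<And>x y. x \<in> K \<Longrightarrow> y \<in> V - {a, b} \<Longrightarrow> d a y + d y b = d a b \<Longrightarrow>
        d a x + d x y + d y b = d a b \<or> d a y + d y x + d x b = d a b \<Longrightarrow> y \<in> K) \<Longrightarrow>
      K = {m\<in>V - {a, b}. d a m + d m b = d a b}"
begin

text \<open>The weight is a sum over positions, not a \<open>path_sum\<close>, so that it matches
  \<open>cycle_weight\<close> once d is \<open>edge_weight\<close>.\<close>

definition small_cycles :: "('v set \<Rightarrow>\<^sub>0 int) set" where
  "small_cycles = {cycle_class r C | C.
     is_cycle V E C \<and> (\<Sum>i<length C. d (C ! i) (next_vertex C i)) \<le> 2 * h}"

definition N :: "('v set \<Rightarrow>\<^sub>0 int) set" where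
  "N = generate (homology1 V E r) small_cycles"

lemma small_cycles_kernel: "small_cycles \<subseteq> carrier (homology1 V E r)"
  using cycle_class_in_kernel by (auto simp: small_cycles_def)

lemma N_kernel: "N \<subseteq> carrier (homology1 V E r)"
  unfolding N_def by (rule group.generate_incl[OF group_homology1 small_cycles_kernel])

lemma N_zero [simp]: "0 \<in> N"
  using generate.one[of "homology1 V E r"] by (simp add: N_def)

lemma N_add: "x \<in> N \<Longrightarrow> y \<in> N \<Longrightarrow> x + y \<in> N"
  using generate.eng[of x "homology1 V E r" small_cycles y] by (simp add: N_def)

lemma N_minus: "x \<in> N \<Longrightarrow> - x \<in> N"
  using group.generate_m_inv_closed[OF group_homology1 small_cycles_kernel, of x]
    inv_homology1[of x] N_kernel unfolding N_def by auto

lemma N_diff: "x \<in> N \<Longrightarrow> y \<in> N \<Longrightarrow> x - y \<in> N"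
  using N_add[OF _ N_minus, of x y] by simp

text \<open>A repeated vertex splits the walk into two shorter closed walks whose weights add up to
  its own, so both respect the bound. Without repetition it is a cycle, a single vertex, or an edge
  traversed back and forth, whose chain cancels.\<close>

lemma closed_walk_in_N:
  assumes "vs \<noteq> []" "is_walk (vs @ [hd vs])" "path_sum d (vs @ [hd vs]) \<le> 2 * h"
  shows "path_sum (oriented_edge r) (vs @ [hd vs]) \<in> N"
  using assms
proof (induction "length vs" arbitrary: vs rule: less_induct)
  case less
  show ?case
  proof (cases "distinct vs")
    case True
    consider a where "vs = [a]" | a b where "vs = [a, b]" | "3 \<le> length vs"
    proof -
      have "length vs = 1 \<or> length vs = 2 \<or> 3 \<le> length vs"
        using \<open>vs \<noteq> []\<close> by (cases "length vs") auto
      then show thesis using that by (auto simp: length_Suc_conv numeral_2_eq_2)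
    qed
    then show ?thesis
    proof cases
      case 1
      then show ?thesis using less.prems edge_verts(3)[of a a] by auto
    next
      case 2
      then show ?thesis using less.prems oriented_edge_swap[of a b] by simp
    next
      case 3
      then have "is_cycle V E vs" using True less.prems by (simp add: is_cycle_iff)
      moreover have "(\<Sum>i<length vs. d (vs ! i) (next_vertex vs i)) \<le> 2 * h"
        using less.prems path_sum_closed[of vs d] by simp
      ultimately have "cycle_class r vs \<in> small_cycles" by (auto simp: small_cycles_def)
      then have "cycle_class r vs \<in> N" unfolding N_def by (rule generate.incl)
      then show ?thesis using cycle_class_path_sum[OF \<open>vs \<noteq> []\<close>] by simp
    qed
  next
    case False
    then obtain us x ys zs where vs: "vs = us @ [x] @ ys @ [x] @ zs"
      using not_distinct_decomp by blast
    define a where "a = hd (us @ [x])"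
    have hd: "hd vs = a" "hd (us @ x # zs) = a"
      by (cases us; simp add: vs a_def)+
    note prems = less.prems(2,3)[unfolded hd(1)]
    have split: "path_sum f (vs @ [a])
        = path_sum f ((us @ x # zs) @ [a]) + path_sum f ((x # ys) @ [x])"
      for f :: "'v \<Rightarrow> 'v \<Rightarrow> 'b::comm_monoid_add"
    proof -
      have "path_sum f (vs @ [a]) = path_sum f (us @ [x]) + path_sum f (x # ys @ x # zs @ [a])"
        unfolding vs using path_sum_append[of f us x "ys @ x # zs @ [a]"] by simp
      also have "path_sum f (x # ys @ x # zs @ [a])
          = path_sum f ((x # ys) @ [x]) + path_sum f (x # zs @ [a])"
        using path_sum_append[of f "x # ys" x "zs @ [a]"] by simp
      finally show ?thesis
        using path_sum_append[of f us x "zs @ [a]"] by (simp add: ac_simps)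
    qed
    have "is_walk (us @ x # (ys @ x # (zs @ [a])))" using prems(1) unfolding vs by simp
    then have w1: "is_walk (us @ [x])" "is_walk ((x # ys) @ x # (zs @ [a]))"
      using is_walk_append[of us x "ys @ x # (zs @ [a])"] by auto
    then have w2: "is_walk ((x # ys) @ [x])" "is_walk (x # (zs @ [a]))"
      using is_walk_append[of "x # ys" x "zs @ [a]"] by auto
    have w3: "is_walk ((us @ x # zs) @ [a])"
      using w1 w2 is_walk_append[of us x "zs @ [a]"] by auto
    have "path_sum (oriented_edge r) ((us @ x # zs) @ [a]) \<in> N"
      using less.hyps[of "us @ x # zs"] w3 prems(2) unfolding split hd(2) by (simp add: vs)
    moreover have "path_sum (oriented_edge r) ((x # ys) @ [x]) \<in> N"
      using less.hyps[of "x # ys"] w2 prems(2) unfolding split by (simp add: vs)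
    ultimately show ?thesis unfolding hd(1) split by (rule N_add)
  qed
qed

section \<open>Walks recorded by their ends, weight and chain\<close>

inductive walk :: "'v \<Rightarrow> 'v \<Rightarrow> nat \<Rightarrow> ('v set \<Rightarrow>\<^sub>0 int) \<Rightarrow> bool" where
  refl: "a \<in> V \<Longrightarrow> walk a a 0 0"
| step: "{a, m} \<in> E \<Longrightarrow> walk m b w x \<Longrightarrow> walk a b (d a m + w) (oriented_edge r a m + x)"

lemma walk_verts: "walk a b w x \<Longrightarrow> a \<in> V \<and> b \<in> V"
  by (induction rule: walk.induct) (auto dest: edge_verts)

lemma walk_length: "walk a b w x \<Longrightarrow> d a b \<le> w"
proof (induction rule: walk.induct)
  case (step a m b w x)
  then have "d a b \<le> d a m + d m b"
    using triangle walk_verts[OF step(2)] edge_verts[OF step(1)] by blast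
  with step show ?case by simp
qed (simp add: d_eq_0)

lemma walk_edge: "{a, b} \<in> E \<Longrightarrow> walk a b (d a b) (oriented_edge r a b)"
  using walk.step[of a b b 0 0] walk.refl[of b] edge_verts[of a b] by simp

lemma walk_trans: "walk a b w x \<Longrightarrow> walk b c w' y \<Longrightarrow> walk a c (w + w') (x + y)"
  by (induction rule: walk.induct) (auto simp: add.assoc intro: walk.step)

lemma walk_rev: "walk a b w x \<Longrightarrow> walk b a w (- x)"
proof (induction rule: walk.induct)
  case (step a m b w x)
  have "walk m a (d a m) (- oriented_edge r a m)"
    using walk_edge[of m a] step(1) oriented_edge_swap[OF step(1)] d_commute edge_verts[OF step(1)]
    by (simp add: insert_commute)
  from walk_trans[OF step(3) this] show ?case by (simp add: add.commute)
qed (simp add: walk.refl)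

lemma walk_list:
  "walk a b w x \<Longrightarrow> \<exists>vs. is_walk (vs @ [b]) \<and> hd (vs @ [b]) = a \<and>
     path_sum d (vs @ [b]) = w \<and> path_sum (oriented_edge r) (vs @ [b]) = x"
proof (induction rule: walk.induct)
  case (refl a)
  then show ?case by (intro exI[of _ "[]"]) simp
next
  case (step a m b w x)
  then obtain vs where vs: "is_walk (vs @ [b])" "hd (vs @ [b]) = m"
     "path_sum d (vs @ [b]) = w" "path_sum (oriented_edge r) (vs @ [b]) = x" by blast
  moreover from vs(2) obtain ys where "vs @ [b] = m # ys" by (cases vs) auto
  ultimately show ?case
    using step(1) edge_verts[OF step(1)] by (intro exI[of _ "a # vs"]) simp
qed

lemma walk_closed:
  assumes "walk a a w x" "w \<le> 2 * h"
  shows "x \<in> N"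
proof -
  obtain vs where vs: "is_walk (vs @ [a])" "hd (vs @ [a]) = a"
     "path_sum d (vs @ [a]) = w" "path_sum (oriented_edge r) (vs @ [a]) = x"
    using walk_list[OF assms(1)] by blast
  show ?thesis
  proof (cases "vs = []")
    case True
    then show ?thesis using vs by auto
  next
    case False
    then have "hd vs = a" using vs(2) by (cases vs) auto
    then show ?thesis using closed_walk_in_N[OF False] vs assms(2) by simp
  qed
qed

section \<open>Geodesics modulo short cycles\<close>

abbreviation geodesic :: "'v \<Rightarrow> 'v \<Rightarrow> ('v set \<Rightarrow>\<^sub>0 int) \<Rightarrow> bool" where
  "geodesic a b x \<equiv> walk a b (d a b) x"

lemma geodesic_exists: "a \<in> V \<Longrightarrow> b \<in> V \<Longrightarrow> \<exists>x. geodesic a b x"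
proof (induction "d a b" arbitrary: a rule: less_induct)
  case less
  show ?case
  proof (cases "a = b")
    case True
    then show ?thesis using walk.refl less.prems d_eq_0 by metis
  next
    case False
    then obtain m where m: "{a, m} \<in> E" "d a m + d m b = d a b"
      using geodesic_step less.prems by blast
    then have "0 < d a m" using d_eq_0 edge_verts[OF m(1)] by fastforce
    then obtain x where "geodesic m b x"
      using less.hyps[of m] m edge_verts[OF m(1)] less.prems by auto
    from walk.step[OF m(1) this] m(2) show ?thesis by auto
  qed
qed

text \<open>By \<open>geodesic_unique\<close> the choice is immaterial modulo N.\<close>

definition geo :: "'v \<Rightarrow> 'v \<Rightarrow> ('v set \<Rightarrow>\<^sub>0 int)" where
  "geo a b = (SOME x. geodesic a b x)"

lemma geodesic_geo: "a \<in> V \<Longrightarrow> b \<in> V \<Longrightarrow> geodesic a b (geo a b)"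
  unfolding geo_def by (rule someI_ex) (rule geodesic_exists)

lemma geodesic_trans:
  "geodesic a m x \<Longrightarrow> geodesic m b y \<Longrightarrow> d a m + d m b = d a b \<Longrightarrow> geodesic a b (x + y)"
  using walk_trans[of a m "d a m" x b "d m b" y] by simp

lemma geodesic_first_edge:
  assumes "geodesic a b x" "a \<noteq> b"
  obtains m y where "{a, m} \<in> E" "geodesic m b y" "d a m + d m b = d a b"
    "x = oriented_edge r a m + y"
  using assms(1)
proof (cases rule: walk.cases)
  case refl
  then show thesis using assms(2) by simp
next
  case (step m w y)
  have "d a b \<le> d a m + d m b" "d m b \<le> w"
    using triangle walk_verts[OF step(4)] edge_verts[OF step(3)] walk_length[OF step(4)] by blast+
  then have "w = d m b" using step(1) by simp
  with step that show thesis by simp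
qed

lemma geodesic_unique: "geodesic a b x \<Longrightarrow> geodesic a b y \<Longrightarrow> x - y \<in> N"
proof (induction "d a b" arbitrary: a b x y rule: less_induct)
  case less
  have V: "a \<in> V" "b \<in> V" using walk_verts[OF less.prems(1)] by auto
  show ?case
  proof (cases "d a b \<le> h")
    case True
    have "walk a a (d a b + d a b) (x - y)"
      using walk_trans[OF less.prems(1) walk_rev[OF less.prems(2)]] by simp
    then show ?thesis by (rule walk_closed) (use True in simp)
  next
    case False
    let ?I = "{m\<in>V - {a, b}. d a m + d m b = d a b}"
    \<comment> \<open>Modulo N, f m stands for all geodesics through m: both halves are shorter than
      d a b, so the induction hypothesis applies to them.\<close>
    define f where "f m = geo a m + geo m b" for m
    have less_ab: "d a m < d a b" "d m b < d a b" if "m \<in> ?I" for m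
    proof -
      have "0 < d a m" "0 < d m b" using that d_eq_0 V by fastforce+
      then show "d a m < d a b" "d m b < d a b" using that by auto
    qed
    have through: "\<exists>m\<in>?I. z - f m \<in> N" if z: "geodesic a b z" for z
    proof -
      have "a \<noteq> b" using False d_eq_0 V by fastforce
      then obtain m z' where m: "{a, m} \<in> E" "geodesic m b z'" "d a m + d m b = d a b"
        "z = oriented_edge r a m + z'" using geodesic_first_edge[OF z] by blast
      \<comment> \<open>The second vertex of the geodesic is strictly inside the interval, since an
        edge weighs at most 2 and d a b exceeds h.\<close>
      have "m \<noteq> b" using edge_le[OF m(1)] False two_le by auto
      then have mI: "m \<in> ?I" using m(3) edge_verts[OF m(1)] by auto
      have "oriented_edge r a m - geo a m \<in> N"
        using less.hyps[OF less_ab(1)[OF mI] walk_edge[OF m(1)]] geodesic_geo V mI by blast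
      moreover have "z' - geo m b \<in> N"
        using less.hyps[OF less_ab(2)[OF mI] m(2)] geodesic_geo V mI by blast
      ultimately have "(oriented_edge r a m - geo a m) + (z' - geo m b) \<in> N" by (rule N_add)
      then have "z - f m \<in> N" by (simp add: m(4) f_def algebra_simps)
      then show ?thesis using mI by blast
    qed
    obtain m1 m2 where m: "m1 \<in> ?I" "x - f m1 \<in> N" "m2 \<in> ?I" "y - f m2 \<in> N"
      using through less.prems by meson
    \<comment> \<open>Both f p and f q agree with the geodesic running through p and then q; the
      comparison only involves the shorter intervals from p to b and from a to q.\<close>
    have comparable: "f p - f q \<in> N"
      if pq: "p \<in> ?I" "q \<in> ?I" "d a p + d p q + d q b = d a b" for p q
    proof -
      have pqV: "p \<in> V" "q \<in> V" using pq by auto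
      have "d p b \<le> d p q + d q b" "d a q \<le> d a p + d p q" using triangle pqV V by blast+
      with pq have eq: "d p q + d q b = d p b" "d a p + d p q = d a q" by auto
      have "geo p b - (geo p q + geo q b) \<in> N"
        using less.hyps[OF less_ab(2)[OF pq(1)]] geodesic_trans eq(1) geodesic_geo pqV V by blast
      moreover have "geo a q - (geo a p + geo p q) \<in> N"
        using less.hyps[OF less_ab(1)[OF pq(2)]] geodesic_trans eq(2) geodesic_geo pqV V by blast
      ultimately have "geo p b - (geo p q + geo q b) - (geo a q - (geo a p + geo p q)) \<in> N"
        by (rule N_diff)
      then show ?thesis by (simp add: f_def algebra_simps)
    qed
    have "{p\<in>?I. f p - f m1 \<in> N} = ?I"
    proof (rule interval_connected)
      show "{p\<in>?I. f p - f m1 \<in> N} \<noteq> {}" using m(1) by auto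
      fix p q
      assume p: "p \<in> {p\<in>?I. f p - f m1 \<in> N}" and "q \<in> V - {a, b}" "d a q + d q b = d a b"
        and or: "d a p + d p q + d q b = d a b \<or> d a q + d q p + d p b = d a b"
      then have q: "q \<in> ?I" by blast
      have "f q - f p \<in> N"
      proof (cases "d a p + d p q + d q b = d a b")
        case True
        then have "f p - f q \<in> N" using comparable p q by blast
        from N_minus[OF this] show ?thesis by simp
      next
        case False
        then show ?thesis using or comparable p q by blast
      qed
      then have "(f q - f p) + (f p - f m1) \<in> N" using p by (intro N_add) auto
      then show "q \<in> {p\<in>?I. f p - f m1 \<in> N}" using q by simp
    qed (use V False in auto)
    then have "f m2 - f m1 \<in> N" using m(3) by blast
    then have "(x - f m1) - (f m2 - f m1) - (y - f m2) \<in> N"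
      using N_diff[OF N_diff[OF m(2)] m(4)] by blast
    then show ?thesis by simp
  qed
qed

lemma triangle_in_N:
  "{a, b} \<in> E \<Longrightarrow> c \<in> V \<Longrightarrow> oriented_edge r a b + geo b c - geo a c \<in> N"
proof (induction "d a c" arbitrary: c rule: less_induct)
  case less
  have V: "a \<in> V" "b \<in> V" "c \<in> V" using edge_verts[OF less.prems(1)] less.prems(2) by auto
  have ab: "geodesic a b (oriented_edge r a b)" by (rule walk_edge[OF less.prems(1)])
  have dab: "d b a = d a b" using d_commute V by blast
  consider "d a b + d b c = d a c" | "d a b + d a c = d b c"
    | "d a c = d b c" "d a c < h" | "d a c = d b c" "h \<le> d a c"
    using balanced[OF less.prems] by fastforce
  then show ?case
  proof cases
    case 1
    show ?thesis
      using geodesic_unique[OF geodesic_trans[OF ab geodesic_geo[OF V(2,3)] 1] geodesic_geo[OF V(1,3)]] .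
  next
    case 2
    have "geodesic b a (- oriented_edge r a b)" using walk_rev[OF ab] dab by simp
    from geodesic_unique[OF geodesic_geo[OF V(2,3)]
        geodesic_trans[OF this geodesic_geo[OF V(1,3)]]] 2 dab
    show ?thesis by (simp add: algebra_simps)
  next
    case 3
    have "walk a a (d a b + d b c + d a c) (oriented_edge r a b + geo b c - geo a c)"
      using walk_trans[OF walk_trans[OF ab geodesic_geo[OF V(2,3)]]
          walk_rev[OF geodesic_geo[OF V(1,3)]]] by simp
    \<comment> \<open>The perimeter is at most 2 + 2 * (h - 1) = 2 * h.\<close>
    then show ?thesis by (rule walk_closed) (use 3 edge_le[OF less.prems(1)] in simp)
  next
    case 4
    obtain m where m: "m \<in> V" "m \<noteq> c" "d a m + d m c = d a c" "d b m + d m c = d b c"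
      using descend[OF less.prems 4] by blast
    have "0 < d m c" using m d_eq_0 V by fastforce
    then have "oriented_edge r a b + geo b m - geo a m \<in> N" (is "?x \<in> N")
      using less.hyps[of m] m less.prems(1) by simp
    moreover have "geo a c - (geo a m + geo m c) \<in> N" (is "?y \<in> N")
      using geodesic_unique[OF geodesic_geo[OF V(1,3)] geodesic_trans[OF
          geodesic_geo[OF V(1) m(1)] geodesic_geo[OF m(1) V(3)] m(3)]] .
    moreover have "geo b c - (geo b m + geo m c) \<in> N" (is "?z \<in> N")
      using geodesic_unique[OF geodesic_geo[OF V(2,3)] geodesic_trans[OF
          geodesic_geo[OF V(2) m(1)] geodesic_geo[OF m(1) V(3)] m(4)]] .
    \<comment> \<open>The triangle with apex m is filled by induction. Routing both sides through m
      extends it to c, and the common tail \<open>geo m c\<close> cancels.\<close>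
    ultimately have "?x - ?y + ?z \<in> N" by (intro N_add[OF N_diff])
    then show ?thesis by (simp add: algebra_simps)
  qed
qed

theorem generate_small_cycles: "generate (homology1 V E r) small_cycles = carrier (homology1 V E r)"
proof (rule antisym)
  show "generate (homology1 V E r) small_cycles \<subseteq> carrier (homology1 V E r)"
    using N_kernel by (simp add: N_def)
  show "carrier (homology1 V E r) \<subseteq> generate (homology1 V E r) small_cycles"
  proof
    fix z assume z: "z \<in> carrier (homology1 V E r)"
    then have keys: "Poly_Mapping.keys z \<subseteq> E" and "boundary1 r z = 0" by (simp_all add: kernel_iff)
    \<comment> \<open>If V is empty this value is arbitrary, but then there are no edges. Membership
      of c in V is derived below from the end of an edge.\<close>
    define c where "c = (SOME c. c \<in> V)"
    define \<phi> where "\<phi> = frag_extend (\<lambda>v. geo v c)"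
    \<comment> \<open>On an edge from v to w the expression is the closed walk from v to w to c and
      back to v, a triangle already filled. It is additive in z, hence in N for every chain, and its
      second term vanishes on boundary-zero chains.\<close>
    have "z - \<phi> (boundary1 r z) \<in> N"
      using keys
    proof (induction z rule: frag_induction)
      case zero
      then show ?case by (simp add: \<phi>_def boundary1_def)
    next
      case (diff x y)
      have "x - \<phi> (boundary1 r x) - (y - \<phi> (boundary1 r y)) \<in> N"
        using N_diff[OF diff] .
      then show ?case by (simp add: \<phi>_def boundary1_def frag_extend_diff algebra_simps)
    next
      case (one e)
      then obtain v w where vw: "v \<in> V" "w \<in> V" "v \<noteq> w" "e = {v, w}" using edge_cases by blast
      have "\<exists>v w. e = {v, w} \<and> (v, w) \<in> r"
        using order_cases(1)[OF vw(1-3)] vw(4) by (metis insert_commute)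
      then obtain v w where e: "e = {v, w}" "(v, w) \<in> r" by blast
      have "c \<in> V" unfolding c_def using vw(1) by (rule someI)
      then have "oriented_edge r v w + geo w c - geo v c \<in> N"
        using triangle_in_N one e by blast
      moreover have e_eq: "oriented_edge r v w = frag_of e" using e by (simp add: oriented_edge_def)
      moreover have "boundary1 r (oriented_edge r v w) = frag_of v - frag_of w"
        using boundary1_oriented_edge one e by blast
      then have "\<phi> (boundary1 r (frag_of e)) = geo v c - geo w c"
        by (simp add: e_eq \<phi>_def frag_extend_diff)
      ultimately show ?case by (simp add: diff_diff_eq2)
    qed
    then show "z \<in> generate (homology1 V E r) small_cycles"
      using \<open>boundary1 r z = 0\<close> by (simp add: \<phi>_def N_def)
  qed
qed

end

section \<open>Transversals as subsets of the index set\<close>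

text \<open>Recording which skew pairs are represented by their unstarred element turns transversals
  into vertices of the cube and the edge weight into the Hamming distance.\<close>

definition tr :: "nat \<Rightarrow> nat set \<Rightarrow> elt set" where
  "tr n X = Inl ` X \<union> Inr ` ({1..n} - X)"

definition pair :: "nat \<Rightarrow> elt set" where
  "pair i = {Inl i, Inr i}"

definition coord :: "nat set \<Rightarrow> nat \<Rightarrow> elt" where
  "coord X i = (if i \<in> X then Inl i else Inr i)"

lemma mem_tr [simp]:
  "Inl i \<in> tr n X \<longleftrightarrow> i \<in> X" "Inr i \<in> tr n X \<longleftrightarrow> i \<in> {1..n} \<and> i \<notin> X"
  by (auto simp: tr_def)

lemma mem_pair [simp]: "Inl i \<in> pair j \<longleftrightarrow> i = j" "Inr i \<in> pair j \<longleftrightarrow> i = j"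
  by (auto simp: pair_def)

lemma eq_coord [simp]:
  "Inl k = coord X i \<longleftrightarrow> i \<in> X \<and> k = i" "Inr k = coord X i \<longleftrightarrow> i \<notin> X \<and> k = i"
  "coord X i = Inl k \<longleftrightarrow> i \<in> X \<and> k = i" "coord X i = Inr k \<longleftrightarrow> i \<notin> X \<and> k = i"
  by (auto simp: coord_def)

lemma sum_set_eqI:
  assumes "\<And>k. Inl k \<in> A \<longleftrightarrow> Inl k \<in> B" "\<And>k. Inr k \<in> A \<longleftrightarrow> Inr k \<in> B"
  shows "A = B"
proof (rule Set.set_eqI)
  fix x show "x \<in> A \<longleftrightarrow> x \<in> B" using assms by (cases x) auto
qed

lemma inj_pair: "inj pair"
  by (auto simp: inj_def pair_def doubleton_eq_iff)

lemma skew_pairs_eq: "skew_pairs n = pair ` {1..n}"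
  unfolding skew_pairs_def ground_def pair_def by force

lemma skew_pairs_in_eq: "skew_pairs_in n S = pair ` {i \<in> {1..n}. Inl i \<in> S \<and> Inr i \<in> S}"
  unfolding skew_pairs_in_def skew_pairs_eq by (auto simp: pair_def)

lemma skew_pairs_in_single:
  assumes "\<And>k. k \<in> {1..n} \<Longrightarrow> Inl k \<in> S \<and> Inr k \<in> S \<longleftrightarrow> k = i" "i \<in> {1..n}"
  shows "card (skew_pairs_in n S) = 1"
proof -
  have "{k \<in> {1..n}. Inl k \<in> S \<and> Inr k \<in> S} = {i}" using assms by blast
  then show ?thesis by (simp add: skew_pairs_in_eq)
qed

lemma tr_diff:
  assumes "X \<subseteq> {1..n}" "Y \<subseteq> {1..n}"
  shows "tr n X - tr n Y = coord X ` (X \<triangle> Y)"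
  using assms by (intro sum_set_eqI) (auto simp: coord_def sd_def image_iff split: if_splits)

lemma card_coord_image: "card (coord X ` A) = card A"
  by (intro card_image) (auto simp: inj_on_def coord_def split: if_splits)

lemma edge_weight_tr:
  "X \<subseteq> {1..n} \<Longrightarrow> Y \<subseteq> {1..n} \<Longrightarrow> edge_weight (tr n X) (tr n Y) = card (X \<triangle> Y)"
  by (simp add: edge_weight_def tr_diff card_coord_image)

lemma tr_inject: "tr n X = tr n Y \<longleftrightarrow> X = Y"
proof -
  have "{i. Inl i \<in> tr n Z} = Z" for Z by simp
  then show ?thesis by metis
qed

lemma transversals_eq: "transversals n = tr n ` Pow {1..n}"
proof (intro equalityI subsetI)
  have card: "card (tr n X) = n" "finite (tr n X)" if "X \<subseteq> {1..n}" for X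
  proof -
    have fX: "finite X" using that finite_subset by blast
    have "card (tr n X) = card (Inl ` X :: elt set) + card (Inr ` ({1..n} - X) :: elt set)"
      unfolding tr_def using fX by (intro card_Un_disjoint) auto
    also have "\<dots> = card X + card ({1..n} - X)" by (simp add: card_image inj_on_def)
    also have "\<dots> = n" using that fX card_mono[OF _ that] by (simp add: card_Diff_subset)
    finally show "card (tr n X) = n" .
    show "finite (tr n X)" using fX by (simp add: tr_def)
  qed
  fix T
  {
    assume "T \<in> tr n ` Pow {1..n}"
    then show "T \<in> transversals n"
      using card by (auto simp: transversals_def skew_pairs_in_eq tr_def ground_def)
  next
    assume T: "T \<in> transversals n"
    define X where "X = {i. Inl i \<in> T}"
    have X: "X \<subseteq> {1..n}" using T by (auto simp: X_def transversals_def ground_def)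
    have "T \<subseteq> tr n X"
    proof
      fix e assume e: "e \<in> T"
      then have "e \<in> ground n" using T by (auto simp: transversals_def)
      with e T show "e \<in> tr n X"
        by (cases e) (auto simp: X_def transversals_def ground_def skew_pairs_in_eq)
    qed
    then have "T = tr n X" using card[OF X] T by (intro card_subset_eq) (auto simp: transversals_def)
    then show "T \<in> tr n ` Pow {1..n}" using X by blast
  }
qed

section \<open>Exchange among the index sets of transversal bases\<close>

context antisymmetric_matroid
begin

definition \<V> :: "nat set set" where
  "\<V> = {X. X \<subseteq> {1..n} \<and> tr n X \<in> \<B>}"

lemma tbg_verts_eq: "tbg_verts n \<B> = tr n ` \<V>"
  by (auto simp: tbg_verts_def transversals_eq \<V>_def)

text \<open>The almost-transversal in question depends on X only outside i and j, so it belongs to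
  the two-dimensional face of the cube through X in these directions.\<close>

definition face :: "nat set \<Rightarrow> nat \<Rightarrow> nat \<Rightarrow> bool" where
  "face X i j \<longleftrightarrow> (tr n X \<union> pair j) - pair i \<in> \<B>"

lemma face_swap:
  assumes "X \<subseteq> {1..n}" "i \<in> {1..n}" "j \<in> {1..n}" "i \<noteq> j"
  shows "face X i j \<longleftrightarrow> face X j i"
  unfolding face_def
  using assms inj_pair by (intro B2) (auto simp: transversals_eq skew_pairs_eq inj_def)

text \<open>By (B2), the two almost-transversals of a face of the cube occur together; exchanging
  between them yields a pair of opposite vertices of that face.\<close>
lemma face_diagonal:
  assumes "face X i j" and X: "X \<subseteq> {1..n}" and i: "i \<in> {1..n}" and j: "j \<in> {1..n}" and "i \<noteq> j"
  shows "X \<triangle> {i, j} \<in> \<V> \<or> X \<triangle> {i} \<in> \<V> \<and> X \<triangle> {j} \<in> \<V>"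
proof -
  let ?B = "(tr n X \<union> pair j) - pair i" and ?B' = "(tr n X \<union> pair i) - pair j"
  let ?e = "coord X j"
  have "?B \<in> \<B>" "?B' \<in> \<B>" using assms face_swap[of X i j] by (simp_all add: face_def)
  moreover have "?e \<in> ?B - ?B'" using X j \<open>i \<noteq> j\<close> by (auto simp: coord_def)
  moreover have "skew_pairs_in n (?B - {?e}) = {}"
    by (auto simp: skew_pairs_in_eq coord_def)
  moreover have "card (skew_pairs_in n (?B' \<union> {?e})) = 1"
    using i \<open>i \<noteq> j\<close> by (intro skew_pairs_in_single) (auto simp: coord_def)
  ultimately obtain f where f: "f \<in> ?B' - ?B" "(?B - {?e}) \<union> {f} \<in> \<B>" "(?B' \<union> {?e}) - {f} \<in> \<B>"
    using Exch by blast
  from f(1) have "f \<in> pair i" by auto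
  \<comment> \<open>In the first case the two exchanged sets are the corners adjacent to X. In the
    second they are X itself and the opposite corner, and only the latter is recorded.\<close>
  then consider "f = coord X i" | "f = coord (X \<triangle> {i}) i"
    by (cases "i \<in> X") (auto simp: pair_def coord_def sd_def)
  then show ?thesis
  proof cases
    case 1
    have "(?B - {?e}) \<union> {f} = tr n (X \<triangle> {j})" "(?B' \<union> {?e}) - {f} = tr n (X \<triangle> {i})"
      using X i j \<open>i \<noteq> j\<close> by (unfold 1; intro sum_set_eqI; auto simp: sd_def)+
    with f X i j show ?thesis by (auto simp: \<V>_def sd_def)
  next
    case 2
    have "(?B - {?e}) \<union> {f} = tr n (X \<triangle> {i, j})"
      using X i j \<open>i \<noteq> j\<close> by (unfold 2; intro sum_set_eqI; auto simp: sd_def)+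
    with f X i j show ?thesis by (auto simp: \<V>_def sd_def)
  qed
qed

text \<open>Exchange removes the i-th element of X and brings in an element of Y at some coordinate
  j. For j = i this would flip i in X, which is excluded; for j \<noteq> i both exchanged sets
  double one of the coordinates i, j and miss the other, so they are the almost-transversals of two
  faces.\<close>

lemma exchange_transversals:
  assumes X: "X \<in> \<V>" and Y: "Y \<in> \<V>" and i: "i \<in> X \<triangle> Y" and "X \<triangle> {i} \<notin> \<V>"
  obtains j where "j \<in> X \<triangle> Y" "j \<noteq> i" "face X i j" "face Y i j"
proof -
  have sub: "X \<subseteq> {1..n}" "Y \<subseteq> {1..n}" using X Y by (auto simp: \<V>_def)
  have in_range: "k \<in> {1..n}" if "k \<in> X \<triangle> Y" for k using that sub by (auto simp: sd_def)
  let ?e = "coord X i"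
  have "tr n X \<in> \<B>" "tr n Y \<in> \<B>" using X Y by (auto simp: \<V>_def)
  moreover have "?e \<in> tr n X - tr n Y" using i sub tr_diff by blast
  moreover have "skew_pairs_in n (tr n X - {?e}) = {}"
    by (auto simp: skew_pairs_in_eq)
  moreover have "card (skew_pairs_in n (tr n Y \<union> {?e})) = 1"
    using i in_range[OF i] by (intro skew_pairs_in_single[of _ _ i]) (auto simp: coord_def sd_def)
  ultimately obtain f where f: "f \<in> tr n Y - tr n X" "(tr n X - {?e}) \<union> {f} \<in> \<B>"
    "(tr n Y \<union> {?e}) - {f} \<in> \<B>" using Exch by blast
  have "f \<in> coord Y ` (Y \<triangle> X)" using f(1) tr_diff[OF sub(2,1)] by simp
  then obtain j where j: "f = coord Y j" "j \<in> X \<triangle> Y" by (auto simp: sd_commute)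
  note ij = in_range[OF i] in_range[OF j(2)]
  have "j \<noteq> i"
  proof
    assume "j = i"
    have "(tr n X - {?e}) \<union> {f} = tr n (X \<triangle> {i})"
      using i ij sub by (unfold j(1) \<open>j = i\<close>; intro sum_set_eqI; auto simp: sd_def)
    then have "X \<triangle> {i} \<in> \<V>" using f(2) sub ij by (auto simp: \<V>_def sd_def)
    with assms show False by simp
  qed
  have "(tr n X - {?e}) \<union> {f} = (tr n X \<union> pair j) - pair i"
    "(tr n Y \<union> {?e}) - {f} = (tr n Y \<union> pair i) - pair j"
    using i j(2) ij sub \<open>j \<noteq> i\<close> by (unfold j(1); intro sum_set_eqI; auto simp: sd_def)+
  then have "face X i j" "face Y j i" using f by (simp_all add: face_def)
  with that j(2) \<open>j \<noteq> i\<close> face_swap[OF sub(2) ij(2,1)] show thesis by blast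
qed

lemma exchange_system_\<V>: "exchange_system \<V>"
  unfolding exchange_system_def
proof (intro ballI impI)
  fix X Y i
  assume *: "X \<in> \<V>" "Y \<in> \<V>" "i \<in> X \<triangle> Y" "X \<triangle> {i} \<notin> \<V>"
  then obtain j where j: "j \<in> X \<triangle> Y" "j \<noteq> i" "face X i j" "face Y i j"
    using exchange_transversals by blast
  have "X \<subseteq> {1..n}" "Y \<subseteq> {1..n}" "i \<in> {1..n}" "j \<in> {1..n}"
    using * j by (auto simp: \<V>_def sd_def)
  with face_diagonal[OF j(3)] face_diagonal[OF j(4)] j *
  show "\<exists>j\<in>X \<triangle> Y - {i}. X \<triangle> {i, j} \<in> \<V> \<and>
      (Y \<triangle> {i, j} \<in> \<V> \<or> Y \<triangle> {i} \<in> \<V> \<and> Y \<triangle> {j} \<in> \<V>)"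
    by (intro bexI[of _ j]) auto
qed

section \<open>The basis graph in cube coordinates\<close>

lemma edge_one: "{tr n X, tr n (X \<triangle> {i})} \<in> tbg_edges n \<B>" if "X \<in> \<V>" "X \<triangle> {i} \<in> \<V>"
proof -
  have sub: "X \<subseteq> {1..n}" "X \<triangle> {i} \<subseteq> {1..n}" using that by (auto simp: \<V>_def)
  have "card (tr n X - tr n (X \<triangle> {i})) = 1"
    using tr_diff[OF sub] by (simp add: card_coord_image)
  moreover have "tr n X \<noteq> tr n (X \<triangle> {i})" using tr_inject[of n X] by (auto simp: sd_def)
  ultimately have "tbg_adj n \<B> (tr n X) (tr n (X \<triangle> {i}))" by (simp add: tbg_adj_def)
  then show ?thesis using that by (auto simp: tbg_edges_def tbg_verts_eq)
qed

text \<open>The almost-transversal of the face is the witness required for adjacency at distance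
  2.\<close>

lemma edge_two: "{tr n X, tr n (X \<triangle> {i, j})} \<in> tbg_edges n \<B>"
  if "X \<in> \<V>" "X \<triangle> {i, j} \<in> \<V>" "face X i j" "i \<noteq> j" "i \<in> {1..n}" "j \<in> {1..n}"
proof -
  have sub: "X \<subseteq> {1..n}" "X \<triangle> {i, j} \<subseteq> {1..n}" using that by (auto simp: \<V>_def)
  let ?A = "(tr n X \<union> pair j) - pair i"
  have "card (tr n X - tr n (X \<triangle> {i, j})) = 2"
    using tr_diff[OF sub] that by (simp add: card_coord_image del: image_insert)
  moreover have "tr n X \<noteq> tr n (X \<triangle> {i, j})" using tr_inject[of n X] by (auto simp: sd_def)
  moreover have "?A \<in> \<B> \<inter> almost_transversals n"
  proof -
    have "pair j \<in> skew_pairs_in n ?A" using that by (auto simp: skew_pairs_in_eq)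
    then have "?A \<notin> transversals n" by (auto simp: transversals_def)
    then show ?thesis using bases_subset that(3) by (auto simp: face_def)
  qed
  moreover have "tr n X - ?A = {coord X i}" "tr n (X \<triangle> {i, j}) - ?A = {coord (X \<triangle> {i, j}) i}"
    using sub that(4-6) by (intro sum_set_eqI; auto simp: sd_def)+
  then have "card (tr n X - ?A) = 1" "card (tr n (X \<triangle> {i, j}) - ?A) = 1" by simp_all
  ultimately have "tbg_adj n \<B> (tr n X) (tr n (X \<triangle> {i, j}))" unfolding tbg_adj_def by blast
  then show ?thesis using that by (auto simp: tbg_edges_def tbg_verts_eq)
qed

lemma edge_tr:
  assumes "{a, b} \<in> tbg_edges n \<B>"
  obtains X Y where "X \<in> \<V>" "Y \<in> \<V>" "a = tr n X" "b = tr n Y" "X \<noteq> Y" "card (X \<triangle> Y) \<le> 2"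
proof -
  obtain B B' where B: "{a, b} = {B, B'}" "B \<in> tbg_verts n \<B>" "B' \<in> tbg_verts n \<B>" "tbg_adj n \<B> B B'"
    using assms by (auto simp: tbg_edges_def)
  obtain X Y where XY: "X \<in> \<V>" "Y \<in> \<V>" "B = tr n X" "B' = tr n Y" using B by (auto simp: tbg_verts_eq)
  have "card (X \<triangle> Y) \<le> 2" "X \<noteq> Y"
    using B(4) tr_diff[of X n Y] XY by (auto simp: tbg_adj_def \<V>_def card_coord_image)
  moreover have "card (Y \<triangle> X) \<le> 2" using calculation by (simp add: sd_commute)
  ultimately show thesis using that XY B(1) by (auto simp: doubleton_eq_iff)
qed

lemma finite_\<V>: "X \<in> \<V> \<Longrightarrow> finite X"
  by (auto simp: \<V>_def intro: finite_subset)

lemma weight_tr: "X \<in> \<V> \<Longrightarrow> Y \<in> \<V> \<Longrightarrow> edge_weight (tr n X) (tr n Y) = card (X \<triangle> Y)"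
  by (rule edge_weight_tr) (auto simp: \<V>_def)

text \<open>This rests on \<open>exchange_transversals\<close> and not on
  \<open>exchange_system\<close>, which has forgotten the face that makes a step of weight 2 an
  edge.\<close>

lemma geodesic_step:
  assumes "X \<in> \<V>" "Y \<in> \<V>" "X \<noteq> Y"
  shows "\<exists>M\<in>\<V>. {tr n X, tr n M} \<in> tbg_edges n \<B> \<and> X \<triangle> M \<subseteq> X \<triangle> Y"
proof -
  obtain i where i: "i \<in> X \<triangle> Y" using assms(3) by (auto simp: sd_def)
  show ?thesis
  proof (cases "X \<triangle> {i} \<in> \<V>")
    case True
    then show ?thesis using i edge_one assms(1) by (intro bexI[of _ "X \<triangle> {i}"]) auto
  next
    case False
    then obtain j where j: "j \<in> X \<triangle> Y" "j \<noteq> i" "face X i j"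
      using exchange_transversals assms(1,2) i by blast
    have "X \<subseteq> {1..n}" "i \<in> {1..n}" "j \<in> {1..n}"
      using assms i j by (auto simp: \<V>_def sd_def)
    moreover from this have "X \<triangle> {i, j} \<in> \<V>" using face_diagonal[OF j(3)] j(2) False by blast
    ultimately show ?thesis
      using i j edge_two[of X i j] assms(1) by (intro bexI[of _ "X \<triangle> {i, j}"]) auto
  qed
qed

text \<open>The symmetric differences of X and Y with Z have equal size but differ in at most two
  points, so each exceeds their intersection by exactly one. Seen from Z this is the situation of
  \<open>exchange_system_below\<close>, and whatever lies inside the intersection is between Z and
  both X and Y.\<close>

lemma descend:
  assumes X: "X \<in> \<V>" and Y: "Y \<in> \<V>" and Z: "Z \<in> \<V>" and "X \<noteq> Y" and XY: "card (X \<triangle> Y) \<le> 2"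
    and eq: "card (X \<triangle> Z) = card (Y \<triangle> Z)" and ge: "4 \<le> card (X \<triangle> Z)"
  shows "\<exists>M\<in>\<V>. M \<noteq> Z \<and> Z \<triangle> M \<subseteq> (Z \<triangle> X) \<inter> (Z \<triangle> Y)"
proof -
  let ?A = "X \<triangle> Z" and ?C = "Y \<triangle> Z"
  have fin: "finite ?A" "finite ?C" using finite_\<V> X Y Z by (auto simp: sd_def)
  have "card (?A \<triangle> ?C) + 2 * card (?A \<inter> ?C) = 2 * card ?A"
    using card_sd[OF fin] eq by simp
  moreover have "?A \<triangle> ?C = X \<triangle> Y" by simp
  moreover have "card (X \<triangle> Y) \<noteq> 0"
    using \<open>X \<noteq> Y\<close> finite_\<V>[OF X] finite_\<V>[OF Y] by (auto simp: sd_def)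
  ultimately have inter: "card ?A = Suc (card (?A \<inter> ?C))" using XY by simp
  then have "card (?A - ?A \<inter> ?C) = 1" using fin by (simp add: card_Diff_subset)
  then obtain i where i: "?A - ?A \<inter> ?C = {i}" by (auto simp: card_1_singleton_iff)
  then have A: "insert i (?A \<inter> ?C) = ?A" "i \<notin> ?A \<inter> ?C" by blast+
  have "\<exists>U\<in>{U. U \<triangle> Z \<in> \<V>}. U \<noteq> {} \<and> U \<subseteq> ?A \<inter> ?C"
  proof (rule exchange_system_below[OF exchange_system_twist[OF exchange_system_\<V>]])
    show "insert i (?A \<inter> ?C) \<in> {U. U \<triangle> Z \<in> \<V>}"
      unfolding A using X by (simp add: sd_assoc)
    show "2 \<le> card (?A \<inter> ?C)" using inter ge by simp
  qed (use A(2) Z in auto)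
  then obtain U where U: "U \<triangle> Z \<in> \<V>" "U \<noteq> {}" "U \<subseteq> ?A \<inter> ?C" by blast
  have "Z \<triangle> (U \<triangle> Z) = U" "U \<triangle> Z \<noteq> Z" using U(2) by (auto simp: sd_def)
  with U show ?thesis by (intro bexI[of _ "U \<triangle> Z"]) (auto simp: sd_commute)
qed

lemma weight_between:
  assumes "X \<in> \<V>" "M \<in> \<V>" "Y \<in> \<V>"
  shows "edge_weight (tr n X) (tr n M) + edge_weight (tr n M) (tr n Y) = edge_weight (tr n X) (tr n Y)
    \<longleftrightarrow> X \<triangle> M \<subseteq> X \<triangle> Y"
  using assms card_sd_between_iff[of X M Y] finite_\<V> by (simp add: weight_tr)

text \<open>Twisting by X moves X to the empty set and Y to X \<triangle> Y, so that betweenness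
  becomes inclusion.\<close>

lemma interval_connected:
  assumes X: "X \<in> \<V>" and Y: "Y \<in> \<V>" and ge: "5 \<le> card (X \<triangle> Y)"
    and ne: "L \<noteq> {}" and L: "L \<subseteq> {M\<in>\<V> - {X, Y}. X \<triangle> M \<subseteq> X \<triangle> Y}"
    and cl: "\<And>M M'. M \<in> L \<Longrightarrow> M' \<in> \<V> - {X, Y} \<Longrightarrow> X \<triangle> M' \<subseteq> X \<triangle> Y \<Longrightarrow>
      X \<triangle> M \<subseteq> X \<triangle> M' \<or> X \<triangle> M' \<subseteq> X \<triangle> M \<Longrightarrow> M' \<in> L"
  shows "L = {M\<in>\<V> - {X, Y}. X \<triangle> M \<subseteq> X \<triangle> Y}"
proof -
  let ?W = "{U. U \<triangle> X \<in> \<V>}" and ?T = "X \<triangle> Y"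
  have interior: "U \<triangle> X \<in> \<V> - {X, Y} \<and> X \<triangle> (U \<triangle> X) \<subseteq> ?T \<longleftrightarrow> U \<in> ?W \<and> U \<noteq> {} \<and> U \<subset> ?T" for U
  proof -
    have "X \<triangle> (U \<triangle> X) = U" by (simp add: sd_commute[of U])
    moreover have "U \<triangle> X = X \<longleftrightarrow> U = {}" "U \<triangle> X = Y \<longleftrightarrow> U = ?T" by (auto simp: sd_def)
    ultimately show ?thesis by auto
  qed
  have twist: "X \<triangle> M \<triangle> X = M" for M by (simp add: sd_commute[of "X \<triangle> M"])
  have cancel: "X \<triangle> (U \<triangle> X) = U" for U by (simp add: sd_commute[of U])
  have "{U. U \<triangle> X \<in> L} = {U\<in>?W. U \<noteq> {} \<and> U \<subset> ?T}"
  proof (rule exchange_system_interval_connected)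
    show "exchange_system ?W" by (rule exchange_system_twist[OF exchange_system_\<V>])
    show "{} \<in> ?W" "?T \<in> ?W" using X Y by (simp_all add: twist)
    show "5 \<le> card ?T" by (rule ge)
    obtain M where "M \<in> L" using ne by blast
    then have "X \<triangle> M \<in> {U. U \<triangle> X \<in> L}" by (simp add: twist)
    then show "{U. U \<triangle> X \<in> L} \<noteq> {}" by blast
    show "{U. U \<triangle> X \<in> L} \<subseteq> {U\<in>?W. U \<noteq> {} \<and> U \<subset> ?T}"
    proof
      fix U assume "U \<in> {U. U \<triangle> X \<in> L}"
      then have "U \<triangle> X \<in> {M\<in>\<V> - {X, Y}. X \<triangle> M \<subseteq> ?T}" using L by blast
      then show "U \<in> {U\<in>?W. U \<noteq> {} \<and> U \<subset> ?T}" using interior[of U] by simp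
    qed
    fix U U'
    assume U: "U \<in> {U. U \<triangle> X \<in> L}" and U': "U' \<in> ?W" "U' \<noteq> {}" "U' \<subset> ?T"
      and or: "U \<subseteq> U' \<or> U' \<subseteq> U"
    have "U' \<triangle> X \<in> \<V> - {X, Y} \<and> X \<triangle> (U' \<triangle> X) \<subseteq> ?T" using interior[of U'] U' by simp
    then show "U' \<in> {U. U \<triangle> X \<in> L}"
      using cl[of "U \<triangle> X" "U' \<triangle> X"] U or by (simp add: cancel)
  qed
  then have mem: "U \<triangle> X \<in> L \<longleftrightarrow> U \<triangle> X \<in> \<V> - {X, Y} \<and> X \<triangle> (U \<triangle> X) \<subseteq> ?T" for U
    using interior[of U] by blast
  show ?thesis
    using mem[of "X \<triangle> _"] unfolding twist by blast
qed

text \<open>The value 4 is the largest distance not covered by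
  \<open>exchange_system_interval_connected\<close>; it yields the cycle weight 8 = 2 * 4.\<close>

lemma geodesic_graph_tbg:
  assumes "strict_linear_order_on (tbg_verts n \<B>) r"
  shows "geodesic_graph (tbg_verts n \<B>) (tbg_edges n \<B>) r edge_weight 4"
proof
  show "\<exists>v\<in>tbg_verts n \<B>. \<exists>w\<in>tbg_verts n \<B>. v \<noteq> w \<and> e = {v, w}" if "e \<in> tbg_edges n \<B>" for e
    using that by (auto simp: tbg_edges_def tbg_adj_def)
  show "strict_linear_order_on (tbg_verts n \<B>) r" by fact
next
  fix a b assume "a \<in> tbg_verts n \<B>" "b \<in> tbg_verts n \<B>"
  then obtain X Y where [simp]: "a = tr n X" "b = tr n Y" and XY: "X \<in> \<V>" "Y \<in> \<V>"
    by (auto simp: tbg_verts_eq)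
  show "edge_weight a b = edge_weight b a"
    by (simp add: weight_tr XY sd_commute)
  show "edge_weight a b = 0 \<longleftrightarrow> a = b"
    using XY finite_\<V> by (auto simp: weight_tr tr_inject sd_def)
  show "\<exists>m. {a, m} \<in> tbg_edges n \<B> \<and> edge_weight a m + edge_weight m b = edge_weight a b"
    if "a \<noteq> b"
  proof -
    have "X \<noteq> Y" using that by auto
    from geodesic_step[OF XY this] show ?thesis using weight_between[OF XY(1) _ XY(2)] by auto
  qed
  show "K = {m\<in>tbg_verts n \<B> - {a, b}. edge_weight a m + edge_weight m b = edge_weight a b}"
    if K: "4 < edge_weight a b" "K \<noteq> {}"
      "K \<subseteq> {m\<in>tbg_verts n \<B> - {a, b}. edge_weight a m + edge_weight m b = edge_weight a b}"
      "\<And>x y. x \<in> K \<Longrightarrow> y \<in> tbg_verts n \<B> - {a, b} \<Longrightarrow>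
        edge_weight a y + edge_weight y b = edge_weight a b \<Longrightarrow>
        edge_weight a x + edge_weight x y + edge_weight y b = edge_weight a b \<or>
        edge_weight a y + edge_weight y x + edge_weight x b = edge_weight a b \<Longrightarrow> y \<in> K" for K
  proof -
    have I: "{m\<in>tbg_verts n \<B> - {a, b}. edge_weight a m + edge_weight m b = edge_weight a b}
        = tr n ` {M\<in>\<V> - {X, Y}. X \<triangle> M \<subseteq> X \<triangle> Y}"
      using weight_between[OF XY(1) _ XY(2)] by (auto simp: tbg_verts_eq tr_inject)
    define L where "L = {M. tr n M \<in> K}"
    have KL: "K = tr n ` L" using K(3) unfolding I L_def by auto
    have "L = {M\<in>\<V> - {X, Y}. X \<triangle> M \<subseteq> X \<triangle> Y}"
    proof (rule interval_connected[OF XY])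
      show "5 \<le> card (X \<triangle> Y)" using K(1) by (simp add: weight_tr XY)
      show "L \<noteq> {}" using K(2) KL by auto
      show sub: "L \<subseteq> {M\<in>\<V> - {X, Y}. X \<triangle> M \<subseteq> X \<triangle> Y}"
      proof
        fix M assume "M \<in> L"
        then have "tr n M \<in> tr n ` {M\<in>\<V> - {X, Y}. X \<triangle> M \<subseteq> X \<triangle> Y}"
          using K(3) unfolding I L_def by blast
        then show "M \<in> {M\<in>\<V> - {X, Y}. X \<triangle> M \<subseteq> X \<triangle> Y}"
          unfolding image_iff tr_inject by blast
      qed
      fix M M'
      assume M: "M \<in> L" and M': "M' \<in> \<V> - {X, Y}" "X \<triangle> M' \<subseteq> X \<triangle> Y"
        and or: "X \<triangle> M \<subseteq> X \<triangle> M' \<or> X \<triangle> M' \<subseteq> X \<triangle> M"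
      have MV: "M \<in> \<V>" "M' \<in> \<V>" "X \<triangle> M \<subseteq> X \<triangle> Y" using M M' sub by auto
      have "tr n M' \<in> K"
      proof (rule K(4))
        show "tr n M \<in> K" using M by (simp add: L_def)
        show "tr n M' \<in> tbg_verts n \<B> - {a, b}" using M' by (auto simp: tbg_verts_eq tr_inject)
        show "edge_weight a (tr n M') + edge_weight (tr n M') b = edge_weight a b"
          using weight_between[OF XY(1) MV(2) XY(2)] M'(2) by simp
        show "edge_weight a (tr n M) + edge_weight (tr n M) (tr n M') + edge_weight (tr n M') b
              = edge_weight a b \<or>
            edge_weight a (tr n M') + edge_weight (tr n M') (tr n M) + edge_weight (tr n M) b
              = edge_weight a b"
          using or weight_between[OF XY(1) MV(1,2)] weight_between[OF XY(1) MV(2,1)]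
            weight_between[OF XY(1) MV(2) XY(2)] weight_between[OF XY(1) MV(1) XY(2)] M'(2) MV(3)
          by simp metis
      qed
      then show "M' \<in> L" by (simp add: L_def)
    qed
    then show ?thesis unfolding I KL by simp
  qed
next
  fix a b c assume "a \<in> tbg_verts n \<B>" "b \<in> tbg_verts n \<B>" "c \<in> tbg_verts n \<B>"
  then show "edge_weight a c \<le> edge_weight a b + edge_weight b c"
    using card_sd_triangle[OF finite_\<V> finite_\<V> finite_\<V>]
    by (auto simp: tbg_verts_eq weight_tr)
next
  fix a b assume ab: "{a, b} \<in> tbg_edges n \<B>"
  obtain X Y where XY: "X \<in> \<V>" "Y \<in> \<V>" and [simp]: "a = tr n X" "b = tr n Y"
    and ne: "X \<noteq> Y" and le: "card (X \<triangle> Y) \<le> 2" using edge_tr[OF ab] by metis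
  note fin = finite_\<V>[OF XY(1)] finite_\<V>[OF XY(2)]
  show "edge_weight a b \<le> 2" using le XY by (simp add: weight_tr)
  fix c assume "c \<in> tbg_verts n \<B>"
  then obtain Z where Z: "Z \<in> \<V>" and [simp]: "c = tr n Z" by (auto simp: tbg_verts_eq)
  have finZ: "finite (X \<triangle> Z)" "finite (Y \<triangle> Z)" "finite Z"
    using fin finite_\<V>[OF Z] by (auto simp: sd_def)
  have "card (X \<triangle> Y) + 2 * card ((X \<triangle> Z) \<inter> (Y \<triangle> Z)) = card (X \<triangle> Z) + card (Y \<triangle> Z)"
    using card_sd[OF finZ(1,2)] by simp
  moreover have "card (X \<triangle> Z) \<le> card (X \<triangle> Y) + card (Y \<triangle> Z)"
    by (rule card_sd_triangle) (use fin finZ in auto)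
  moreover have "card (Y \<triangle> Z) \<le> card (X \<triangle> Y) + card (X \<triangle> Z)"
    using card_sd_triangle[of Y X Z] fin finZ by (simp add: sd_commute)
  \<comment> \<open>Parity: the distances of X and Y from Z have a sum congruent modulo 2 to their
    mutual distance, which is at most 2. So they differ by that full distance or not at all.\<close>
  ultimately have "card (X \<triangle> Z) = card (X \<triangle> Y) + card (Y \<triangle> Z) \<or>
      card (Y \<triangle> Z) = card (X \<triangle> Y) + card (X \<triangle> Z) \<or> card (X \<triangle> Z) = card (Y \<triangle> Z)"
    using le by presburger
  then show "edge_weight a c = edge_weight a b + edge_weight b c \<or>
      edge_weight b c = edge_weight a b + edge_weight a c \<or> edge_weight a c = edge_weight b c"
    by (simp add: weight_tr XY Z)
  assume eq: "edge_weight a c = edge_weight b c" "4 \<le> edge_weight a c"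
  then obtain M where M: "M \<in> \<V>" "M \<noteq> Z" "Z \<triangle> M \<subseteq> (Z \<triangle> X) \<inter> (Z \<triangle> Y)"
    using descend[OF XY Z ne le] by (auto simp: weight_tr XY Z)
  have "edge_weight a (tr n M) + edge_weight (tr n M) c = edge_weight a c"
    "edge_weight b (tr n M) + edge_weight (tr n M) c = edge_weight b c"
    using weight_between[OF Z M(1) XY(1)] weight_between[OF Z M(1) XY(2)] M(3)
    by (simp_all add: weight_tr XY Z M(1) sd_commute)
  then show "\<exists>m\<in>tbg_verts n \<B>. m \<noteq> c \<and> edge_weight a m + edge_weight m c = edge_weight a c \<and>
      edge_weight b m + edge_weight m c = edge_weight b c"
    using M by (intro bexI[of _ "tr n M"]) (auto simp: tbg_verts_eq tr_inject)
qed simp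

end

theorem theorem5p3:
  fixes n :: nat and \<B> :: "elt set set" and r :: "(elt set \<times> elt set) set"
  assumes "antisymmetric_matroid n \<B>"
    and "strict_linear_order_on (tbg_verts n \<B>) r"
  shows "generate (tbg_homology n \<B> r)
           {cycle_class r C | C.
              is_cycle (tbg_verts n \<B>) (tbg_edges n \<B>) C \<and> cycle_weight C \<le> 8}
         = carrier (tbg_homology n \<B> r)"
proof -
  interpret geodesic_graph "tbg_verts n \<B>" "tbg_edges n \<B>" r edge_weight 4
    using antisymmetric_matroid.geodesic_graph_tbg[OF assms] .
  show ?thesis
    using generate_small_cycles by (simp add: small_cycles_def tbg_homology_def cycle_weight_def)
qed

end
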